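(* Let $m\geq 2$ be an integer and let $W\in C^1(\mathbb{R}^m;\mathbb{R})$ be nonnegative. Assume that there exist $Q\in\mathbb{R}^m$, a real number $p\geq 2$ and a constant $C_2>0$ such that $$-(u-Q)\cdot W_u(u)\leq C_2\,\bigl(W(u)\bigr)^{\frac{p-1}{p}}\qquad\text{for all } u\in\mathbb{R}^m .$$ Let $u\in C^2(\mathbb{R}^n;\mathbb{R}^m)$ be a bounded solution of the semilinear elliptic system $$\Delta u=W_u(u)\quad\text{in } \mathbb{R}^n .$$ Then the following hold. (I) If $n\geq 4$ and $$\int_{B_r}W(u(x))\,dx=o(r^{q})\quad\text{as } r\to\infty,\qquad\text{where } q=\frac{p}{p-1}\left(n-2-\frac{n}{p}\right)=n-2-\frac{2}{p-1},$$ then $u$ is constant. (II) If $n=4$, $p=2$, and $$\int_{\mathbb{R}^n}W(u(x))\,dx<\infty,$$ then $u$ is constant.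
   Context: $W_u$ denotes the gradient of $W:\mathbb{R}^m\to\mathbb{R}$, and $\cdot$ denotes the Euclidean inner product of $\mathbb{R}^m$. The Laplacian $\Delta$ acts componentwise on $u=(u_1,\dots,u_m):\mathbb{R}^n\to\mathbb{R}^m$. $B_r$ denotes the $n$-dimensional ball of radius $r$ centered at the origin. $o(\cdot)$ is the standard Landau symbol: $f(r)=o(r^q)$ as $r\to\infty$ means $f(r)/r^q\to 0$ as $r\to\infty$. *)

theory Defs
  imports "HOL-Analysis.Analysis" "HOL-Library.Landau_Symbols"
begin

definition C1_map :: "('a::real_normed_vector \<Rightarrow> 'b::real_normed_vector) \<Rightarrow> bool" where
  "C1_map f \<longleftrightarrow>
     (\<exists>D :: 'a \<Rightarrow> 'a \<Rightarrow>\<^sub>L 'b.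
        (\<forall>x. (f has_derivative blinfun_apply (D x)) (at x)) \<and> continuous_on UNIV D)"

definition C2_map :: "('a::real_normed_vector \<Rightarrow> 'b::real_normed_vector) \<Rightarrow> bool" where
  "C2_map f \<longleftrightarrow>
     (\<exists>D :: 'a \<Rightarrow> 'a \<Rightarrow>\<^sub>L 'b.
        (\<forall>x. (f has_derivative blinfun_apply (D x)) (at x)) \<and> C1_map D)"

text \<open>Only meaningful where \<open>f\<close> is differentiable; the vector is then unique.\<close>

definition grad :: "('a::real_inner \<Rightarrow> real) \<Rightarrow> 'a \<Rightarrow> 'a" where
  "grad f x = (THE D. GDERIV f x :> D)"

lemma grad_eqI: "GDERIV f x :> D \<Longrightarrow> grad f x = D"
proof -
  assume D: "GDERIV f x :> D"
  have "D' = D" if "GDERIV f x :> D'" for D'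
  proof -
    have "(\<lambda>h. inner h D') = (\<lambda>h. inner h D)"
      using that D unfolding gderiv_def by (rule has_derivative_unique)
    then have "\<forall>h. inner h D' = inner h D" by (auto dest: fun_cong)
    then show ?thesis by (simp only: vector_eq_ldot)
  qed
  with D show ?thesis unfolding grad_def by (intro the_equality)
qed

definition partial_deriv :: "'n::finite \<Rightarrow> (real^'n \<Rightarrow> real) \<Rightarrow> real^'n \<Rightarrow> real" where
  "partial_deriv i f x = deriv (\<lambda>t::real. f (x + t *\<^sub>R axis i 1)) 0"

definition laplacian :: "(real^'n::finite \<Rightarrow> real) \<Rightarrow> real^'n \<Rightarrow> real" where
  "laplacian f x = (\<Sum>i\<in>UNIV. partial_deriv i (partial_deriv i f) x)"

definition vec_laplacian :: "(real^'n::finite \<Rightarrow> real^'m::finite) \<Rightarrow> real^'n \<Rightarrow> real^'m" where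
  "vec_laplacian u x = (\<chi> j. laplacian (\<lambda>y. u y $ j) x)"

definition growth_exponent :: "nat \<Rightarrow> real \<Rightarrow> real" where
  "growth_exponent n p = p / (p - 1) * (real n - 2 - real n / p)"

lemma growth_exponent_eq:
  assumes "p \<ge> 2"
  shows "growth_exponent n p = real n - 2 - 2 / (p - 1)"
  using assms by (simp add: growth_exponent_def field_simps)

end

theory Submission
  imports Defs
begin

text \<open>
  Let \<open>e = |Du|\<^sup>2/2 + W(u)\<close>. Since the stress--energy tensor of a solution is divergence free, testing it
  against \<open>x \<omega>\<^sup>2\<close> with \<open>\<omega> = (1 - |x|\<^sup>2/r\<^sup>2)\<^sub>+\<close> gives a Pohozaev identity, which says that the scaled energy
  \<open>G(r) = r\<^bsup>2-n\<^esup> \<integral> \<omega>\<^sup>2 e\<close> satisfies \<open>r G'(r) \<ge> 4 j(r)\<close> with \<open>j(r) = r\<^bsup>-n\<^esup> \<integral> \<omega> |x \<cdot> Du|\<^sup>2 \<ge> 0\<close>. Testing the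
  equation against \<open>\<omega>\<^sup>2 (u - Q)\<close>, where only the radial derivative of \<open>u\<close> meets the gradient of the cutoff,
  gives \<open>G \<le> \<epsilon>(r) + K (\<delta> + j/\<delta>)\<close> for every \<open>\<delta> > 0\<close>, and the hypotheses on \<open>W\<close> force \<open>\<epsilon>(r) \<longlongrightarrow> 0\<close>.
  Hence \<open>r G' \<ge> c (G - \<epsilon>)\<^sup>2\<close> while \<open>G > \<epsilon>\<close>; such a \<open>G\<close> blows up at finite \<open>r\<close>, so \<open>G \<le> \<epsilon>\<close>
  eventually. As \<open>G\<close> is nondecreasing, \<open>G = 0\<close> and \<open>u\<close> is constant.
\<close>

section \<open>Calculus\<close>

lemma integrable_continuous_supported_in_ball:
  fixes f :: "'a::euclidean_space \<Rightarrow> real"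
  assumes "continuous_on UNIV f" and "\<And>x. norm x \<ge> R \<Longrightarrow> f x = 0"
  shows "integrable lborel f"
proof -
  have "integrable lborel (\<lambda>x. indicator (cball 0 R) x *\<^sub>R f x)"
    using assms(1) by (intro borel_integrable_compact) (auto intro: continuous_on_subset)
  also have "(\<lambda>x. indicator (cball 0 R) x *\<^sub>R f x) = f"
    using assms(2) by (auto simp: indicator_def fun_eq_iff)
  finally show ?thesis .
qed

text \<open>The set where \<open>f\<close> is nonzero is open by continuity and null because the
  integral vanishes; a nonempty open set is not negligible.\<close>

lemma continuous_nonneg_integral_eq_0:
  fixes f :: "'a::euclidean_space \<Rightarrow> real"
  assumes cont: "continuous_on UNIV f" and nonneg: "\<And>x. f x \<ge> 0"
    and int: "integrable lborel f" "integral\<^sup>L lborel f = 0"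
  shows "f x = 0"
proof -
  have op: "open {x. f x \<noteq> 0}"
    using open_Collect_neq[OF cont, of "\<lambda>_. 0"] by simp
  have "AE x in lborel. f x = 0"
    using integral_nonneg_eq_0_iff_AE[OF int(1)] int(2) nonneg by simp
  then have "{x. f x \<noteq> 0} \<in> null_sets lborel"
    using op by (subst (asm) AE_iff_null) (auto intro: borel_open)
  then have "negligible {x. f x \<noteq> 0}"
    by (simp add: negligible_iff_null_sets null_sets_completionI)
  then show ?thesis using open_not_negligible[OF op] by blast
qed

text \<open>By translation invariance the difference quotients of \<open>f\<close> already have integral zero.\<close>

lemma integral_directional_derivative_eq_0:
  fixes f :: "'a::euclidean_space \<Rightarrow> real"
  assumes deriv: "\<And>x. (f has_derivative f' x) (at x)"
    and cont: "continuous_on UNIV (\<lambda>x. f' x b)"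
    and supp: "\<And>x. norm x \<ge> R \<Longrightarrow> f x = 0"
  shows "(\<integral>x. f' x b \<partial>lborel) = 0"
proof -
  define h where "h k = inverse (real (Suc k))" for k
  have h: "h k > 0" "h k \<le> 1" for k by (auto simp: h_def field_simps)
  have h0: "h \<longlonglongrightarrow> 0" unfolding h_def by (rule LIMSEQ_inverse_real_of_nat)
  define g where "g k x = (f (h k *\<^sub>R b + x) - f x) / h k" for k x
  \<comment> \<open>Since \<open>h k \<le> 1\<close>, every \<open>g k\<close> vanishes where
    \<open>norm x > R + norm b\<close>, and for the other \<open>x\<close> the mean value point has
    norm at most \<open>R + 2 * norm b\<close>. One bound of the derivative on \<open>K\<close>
    therefore dominates all difference quotients.\<close>
  define K where "K = cball (0::'a) (R + 2 * norm b)"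
  have fcont: "continuous_on UNIV f"
    using deriv by (meson continuous_on_eq_continuous_at has_derivative_continuous open_UNIV)
  have fint: "integrable lborel f"
    by (rule integrable_continuous_supported_in_ball[OF fcont supp])
  have trans: "integrable lborel (\<lambda>x. f (c + x))" "(\<integral>x. f (c + x) \<partial>lborel) = integral\<^sup>L lborel f" for c
  proof -
    have m: "(+) c \<in> measurable lborel borel" "f \<in> borel_measurable borel"
      using fcont by (auto intro: borel_measurable_continuous_onI)
    show "integrable lborel (\<lambda>x. f (c + x))"
      using integrable_distr_eq[OF m] fint by (simp add: lborel_distr_plus)
    show "(\<integral>x. f (c + x) \<partial>lborel) = integral\<^sup>L lborel f"
      using integral_distr[OF m] by (simp add: lborel_distr_plus)
  qed
  have g0: "integral\<^sup>L lborel (g k) = 0" for k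
    unfolding g_def using trans[of "h k *\<^sub>R b"] fint by simp
  have line: "((\<lambda>t. f (x + t *\<^sub>R b)) has_real_derivative f' (x + t *\<^sub>R b) b) (at t)" for x t
  proof -
    have "((\<lambda>t. f (x + t *\<^sub>R b)) has_derivative (\<lambda>s. f' (x + t *\<^sub>R b) (s *\<^sub>R b))) (at t)"
      by (rule has_derivative_compose[OF _ deriv]) (auto intro!: derivative_eq_intros)
    moreover have "f' y (s *\<^sub>R b) = f' y b * s" for y s
      using linear_cmul[OF has_derivative_linear[OF deriv]] by simp
    ultimately show ?thesis by (simp add: has_field_derivative_def)
  qed
  have gmvt: "\<exists>s>0. s < h k \<and> g k x = f' (x + s *\<^sub>R b) b" for k x
  proof -
    obtain s where s: "s > 0" "s < h k"
      "f (x + h k *\<^sub>R b) - f (x + 0 *\<^sub>R b) = (h k - 0) * f' (x + s *\<^sub>R b) b"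
      using MVT2[OF h(1), where f="\<lambda>t. f (x + t *\<^sub>R b)" and f'="\<lambda>t. f' (x + t *\<^sub>R b) b"] line by blast
    then show ?thesis using h(1)[of k] by (intro exI[of _ s]) (auto simp: g_def field_simps)
  qed
  have lim: "(\<lambda>k. g k x) \<longlonglongrightarrow> f' x b" for x
  proof -
    have "((\<lambda>t. (f (x + t *\<^sub>R b) - f x) / t) \<longlongrightarrow> f' x b) (at 0)"
      using line[of x 0] by (simp add: has_field_derivative_iff)
    moreover have "filterlim h (at 0) sequentially"
      using h0 h(1) by (simp add: filterlim_at less_imp_neq[symmetric])
    ultimately show ?thesis
      unfolding g_def by (auto dest: filterlim_compose simp: add.commute)
  qed
  obtain M where M: "\<And>x. x \<in> K \<Longrightarrow> \<bar>f' x b\<bar> \<le> M"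
  proof -
    have "bounded ((\<lambda>x. f' x b) ` K)"
      using cont by (intro compact_imp_bounded compact_continuous_image)
        (auto simp: K_def intro: continuous_on_subset)
    then show ?thesis using that by (auto simp: bounded_iff)
  qed
  define w where "w x = indicator K x *\<^sub>R M" for x
  have wint: "integrable lborel w" unfolding w_def
    by (rule borel_integrable_compact) (auto simp: K_def)
  have bound: "norm (g k x) \<le> w x" for k x
  proof (cases "norm x \<le> R + norm b")
    case True
    obtain s where s: "s > 0" "s < h k" "g k x = f' (x + s *\<^sub>R b) b" using gmvt by blast
    have "norm (x + s *\<^sub>R b) \<le> norm x + s * norm b"
      using norm_triangle_ineq[of x "s *\<^sub>R b"] s by simp
    also have "s * norm b \<le> 1 * norm b"
      using s h(2)[of k] by (intro mult_right_mono) auto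
    finally have "x + s *\<^sub>R b \<in> K" using True by (simp add: K_def)
    moreover have "x \<in> K" using True by (simp add: K_def) (smt (verit) norm_ge_zero)
    ultimately show ?thesis using M s by (simp add: w_def)
  next
    case False
    have "norm x \<le> norm (h k *\<^sub>R b + x) + norm (h k *\<^sub>R b)"
      by (metis add_diff_cancel_left' norm_triangle_ineq4 add.commute)
    moreover have "norm (h k *\<^sub>R b) \<le> norm b"
      using h[of k] by (simp add: mult_left_le_one_le)
    ultimately have "f (h k *\<^sub>R b + x) = 0" using False by (intro supp) auto
    moreover have "norm x \<ge> R" using False norm_ge_zero[of b] by linarith
    \<comment> \<open>The sign of \<open>M\<close> is known only if \<open>K\<close> has a
      point.\<close>
    moreover have "w x \<ge> 0"
    proof (cases "x \<in> K")
      case True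
      then show ?thesis using M[OF True] by (simp add: w_def)
    qed (simp add: w_def)
    ultimately show ?thesis by (simp add: g_def supp)
  qed
  have meas: "(\<lambda>x. f' x b) \<in> borel_measurable lborel" "g k \<in> borel_measurable lborel" for k
    using cont fcont unfolding g_def
    by (auto intro!: borel_measurable_continuous_onI continuous_intros h
        continuous_on_compose2[OF fcont] simp: less_imp_neq[OF h(1), symmetric])
  have "(\<lambda>k. integral\<^sup>L lborel (g k)) \<longlonglongrightarrow> (\<integral>x. f' x b \<partial>lborel)"
    by (rule integral_dominated_convergence[OF meas wint AE_I2[OF lim] AE_I2[OF bound]])
  then show ?thesis unfolding g0 by (simp add: LIMSEQ_const_iff)
qed

lemma integral_divergence_eq_0:
  fixes f :: "'a::euclidean_space \<Rightarrow> 'a \<Rightarrow> real"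
  assumes deriv: "\<And>b x. (f b has_derivative f' b x) (at x)"
    and cont: "\<And>b. continuous_on UNIV (\<lambda>x. f' b x b)"
    and supp: "\<And>b x. norm x \<ge> R \<Longrightarrow> f b x = 0"
  shows "(\<integral>x. (\<Sum>b\<in>Basis. f' b x b) \<partial>lborel) = 0"
proof -
  \<comment> \<open>Enlarging the radius by one gives \<open>x\<close> a whole neighbourhood on
    which \<open>f b\<close> vanishes, so that the derivative there is zero.\<close>
  have "f' b x b = 0" if x: "norm x \<ge> R + 1" for b x
  proof -
    have "(f b has_derivative (\<lambda>h. 0)) (at x)"
    proof (rule has_derivative_transform_within_open)
      show "((\<lambda>x. 0) has_derivative (\<lambda>h. 0)) (at x)" by simp
      show "open (- cball 0 R)" "x \<in> - cball 0 R" using x by auto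
      show "0 = f b y" if "y \<in> - cball 0 R" for y using that supp by auto
    qed
    from has_derivative_unique[OF deriv this] show ?thesis by simp
  qed
  then have "integrable lborel (\<lambda>x. f' b x b)" for b
    by (rule integrable_continuous_supported_in_ball[OF cont])
  moreover have "(\<integral>x. f' b x b \<partial>lborel) = 0" for b
    by (rule integral_directional_derivative_eq_0[OF deriv cont supp])
  ultimately show ?thesis by simp
qed

section \<open>Symmetry of second derivatives\<close>

lemma second_difference_eq:
  fixes f :: "'a::real_normed_vector \<Rightarrow> real"
  assumes f: "\<And>x. (f has_derivative f' x) (at x)"
    and fa: "\<And>x. ((\<lambda>y. f' y a) has_derivative f'' x) (at x)"
    and "h > 0"
  shows "\<exists>s t. 0 < s \<and> s < h \<and> 0 < t \<and> t < h \<and>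
    f (x + h *\<^sub>R a + h *\<^sub>R b) - f (x + h *\<^sub>R a) - f (x + h *\<^sub>R b) + f x
      = h\<^sup>2 * f'' (x + s *\<^sub>R a + t *\<^sub>R b) b"
proof -
  have line: "((\<lambda>s. g (z + s *\<^sub>R c)) has_real_derivative g' (z + s *\<^sub>R c) c) (at s)"
    if g: "\<And>x. (g has_derivative g' x) (at x)" for g :: "'a \<Rightarrow> real" and g' z c s
  proof -
    have "((\<lambda>t. g (z + t *\<^sub>R c)) has_derivative (\<lambda>t. g' (z + s *\<^sub>R c) (t *\<^sub>R c))) (at s)"
      by (rule has_derivative_compose[OF _ g]) (auto intro!: derivative_eq_intros)
    moreover have "g' y (s *\<^sub>R c) = g' y c * s" for y s
      using linear_cmul[OF has_derivative_linear[OF g]] by simp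
    ultimately show ?thesis by (simp add: has_field_derivative_def)
  qed
  \<comment> \<open>The mixed difference is the increment of \<open>d\<close>, a difference in
    direction \<open>b\<close>, along direction \<open>a\<close>. The mean value theorem is applied
    once along \<open>a\<close> to \<open>d\<close> and once along \<open>b\<close> to the
    derivative of \<open>f\<close> in direction \<open>a\<close>.\<close>
  define d where "d s = f ((x + h *\<^sub>R b) + s *\<^sub>R a) - f (x + s *\<^sub>R a)" for s
  define d' where "d' s = f' ((x + h *\<^sub>R b) + s *\<^sub>R a) a - f' (x + s *\<^sub>R a) a" for s
  have "(d has_real_derivative d' s) (at s)" for s
    unfolding d_def d'_def by (intro DERIV_diff line f)
  then obtain s where s: "0 < s" "s < h" "d h - d 0 = (h - 0) * d' s"
    using MVT2[OF \<open>h > 0\<close>, of d d'] by blast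
  define k where "k t = f' ((x + s *\<^sub>R a) + t *\<^sub>R b) a" for t
  have "(k has_real_derivative f'' ((x + s *\<^sub>R a) + t *\<^sub>R b) b) (at t)" for t
    unfolding k_def by (rule line[OF fa])
  then obtain t where t: "0 < t" "t < h" "k h - k 0 = (h - 0) * f'' ((x + s *\<^sub>R a) + t *\<^sub>R b) b"
    using MVT2[OF \<open>h > 0\<close>, of k "\<lambda>t. f'' ((x + s *\<^sub>R a) + t *\<^sub>R b) b"] by blast
  have "d' s = k h - k 0" by (simp add: d'_def k_def algebra_simps)
  then show ?thesis using s t
    by (intro exI[of _ s] exI[of _ t]) (auto simp: d_def algebra_simps power2_eq_square)
qed

text \<open>The mixed second difference does not change when \<open>a\<close> and \<open>b\<close>
  are exchanged. Evaluated in both orders, it equates values of \<open>fa\<close> and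
  \<open>fb\<close> at points that converge to \<open>x\<close>, and continuity at \<open>x\<close>
  passes to the limit.\<close>

lemma second_derivative_symmetric:
  fixes f :: "'a::real_normed_vector \<Rightarrow> real"
  assumes f: "\<And>x. (f has_derivative f' x) (at x)"
    and fa: "\<And>x. ((\<lambda>y. f' y a) has_derivative fa x) (at x)"
    and fb: "\<And>x. ((\<lambda>y. f' y b) has_derivative fb x) (at x)"
    and ca: "isCont (\<lambda>y. fa y b) x" and cb: "isCont (\<lambda>y. fb y a) x"
  shows "fa x b = fb x a"
proof -
  define h where "h k = inverse (real (Suc k))" for k
  have h: "h k > 0" for k by (auto simp: h_def)
  have h0: "h \<longlonglongrightarrow> 0" unfolding h_def by (rule LIMSEQ_inverse_real_of_nat)
  have "\<exists>s t s' t'. 0 < s \<and> s < h k \<and> 0 < t \<and> t < h k \<and> 0 < s' \<and> s' < h k \<and> 0 < t' \<and> t' < h k \<and>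
    fa (x + s *\<^sub>R a + t *\<^sub>R b) b = fb (x + s' *\<^sub>R b + t' *\<^sub>R a) a" for k
  proof -
    obtain s t where st: "0 < s" "s < h k" "0 < t" "t < h k"
      "f (x + h k *\<^sub>R a + h k *\<^sub>R b) - f (x + h k *\<^sub>R a) - f (x + h k *\<^sub>R b) + f x
        = (h k)\<^sup>2 * fa (x + s *\<^sub>R a + t *\<^sub>R b) b"
      using second_difference_eq[OF f fa h[of k], where x=x and b=b] by blast
    obtain s' t' where st': "0 < s'" "s' < h k" "0 < t'" "t' < h k"
      "f (x + h k *\<^sub>R b + h k *\<^sub>R a) - f (x + h k *\<^sub>R b) - f (x + h k *\<^sub>R a) + f x
        = (h k)\<^sup>2 * fb (x + s' *\<^sub>R b + t' *\<^sub>R a) a"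
      using second_difference_eq[OF f fb h[of k], where x=x and b=a] by blast
    have "(h k)\<^sup>2 * fa (x + s *\<^sub>R a + t *\<^sub>R b) b = (h k)\<^sup>2 * fb (x + s' *\<^sub>R b + t' *\<^sub>R a) a"
      using st(5) st'(5) by (simp add: algebra_simps)
    then have "fa (x + s *\<^sub>R a + t *\<^sub>R b) b = fb (x + s' *\<^sub>R b + t' *\<^sub>R a) a"
      using h[of k] by simp
    then show ?thesis using st(1-4) st'(1-4) by blast
  qed
  then obtain s t s' t' where st: "\<And>k. 0 < s k \<and> s k < h k \<and> 0 < t k \<and> t k < h k \<and>
    0 < s' k \<and> s' k < h k \<and> 0 < t' k \<and> t' k < h k \<and>
    fa (x + s k *\<^sub>R a + t k *\<^sub>R b) b = fb (x + s' k *\<^sub>R b + t' k *\<^sub>R a) a"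
    by metis
  have lim0: "q \<longlonglongrightarrow> 0" if "\<And>k. 0 < q k \<and> q k < h k" for q
    using that by (intro tendsto_sandwich[OF _ _ tendsto_const h0]) (auto intro!: always_eventually less_imp_le)
  have "(\<lambda>k. x + s k *\<^sub>R a + t k *\<^sub>R b) \<longlonglongrightarrow> x + 0 *\<^sub>R a + 0 *\<^sub>R b"
    using st by (intro tendsto_intros lim0) auto
  then have A: "(\<lambda>k. fa (x + s k *\<^sub>R a + t k *\<^sub>R b) b) \<longlonglongrightarrow> fa x b"
    using isCont_tendsto_compose[OF ca] by simp
  have "(\<lambda>k. x + s' k *\<^sub>R b + t' k *\<^sub>R a) \<longlonglongrightarrow> x + 0 *\<^sub>R b + 0 *\<^sub>R a"
    using st by (intro tendsto_intros lim0) auto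
  then have B: "(\<lambda>k. fb (x + s' k *\<^sub>R b + t' k *\<^sub>R a) a) \<longlonglongrightarrow> fb x a"
    using isCont_tendsto_compose[OF cb] by simp
  have "(\<lambda>k. fa (x + s k *\<^sub>R a + t k *\<^sub>R b) b) = (\<lambda>k. fb (x + s' k *\<^sub>R b + t' k *\<^sub>R a) a)"
    using st by blast
  then show ?thesis using LIMSEQ_unique[OF A] B by simp
qed

section \<open>One-variable facts: the squared positive part and a Riccati inequality\<close>

lemma DERIV_pos_part_square:
  "((\<lambda>s::real. (max 0 s)\<^sup>2) has_real_derivative 2 * max 0 s) (at s)"
proof -
  consider "s < 0" | "s = 0" | "s > 0" by linarith
  then show ?thesis
  proof cases
    case 1
    have "((\<lambda>s::real. 0) has_real_derivative 2 * max 0 s) (at s)" using 1 by simp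
    then show ?thesis
      by (rule has_field_derivative_transform_within_open[where S = "{..<0}"]) (use 1 in auto)
  next
    case 2
    \<comment> \<open>Squaring removes the corner: the difference quotient at 0 is bounded by the
      modulus of \<open>h\<close>. This is what makes the squared cutoff differentiable across the
      sphere \<open>norm x = r\<close>.\<close>
    have "((\<lambda>h::real. (max 0 h)\<^sup>2 / h) \<longlongrightarrow> 0) (at 0)"
    proof (rule Lim_null_comparison)
      show "\<forall>\<^sub>F h::real in at 0. norm ((max 0 h)\<^sup>2 / h) \<le> \<bar>h\<bar>"
        by (intro always_eventually) (auto simp: max_def power2_eq_square)
      show "((\<lambda>h::real. \<bar>h\<bar>) \<longlongrightarrow> 0) (at 0)" using tendsto_rabs_zero[OF tendsto_ident_at] .
    qed
    then show ?thesis using 2 by (simp add: has_field_derivative_iff)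
  next
    case 3
    have "((\<lambda>s::real. s\<^sup>2) has_real_derivative 2 * max 0 s) (at s)"
      using 3 by (auto intro!: derivative_eq_intros)
    then show ?thesis
      by (rule has_field_derivative_transform_within_open[where S = "{0<..}"]) (use 3 in auto)
  qed
qed

text \<open>If \<open>G r0 > \<epsilon>\<close>, monotonicity keeps \<open>G\<close> above
  \<open>\<epsilon>\<close>, and the inequality says that \<open>- 1 / (G r - \<epsilon>)\<close>
  grows at least as fast as \<open>c * ln r\<close>. A negative quantity cannot do so for all large
  \<open>r\<close>.\<close>

lemma riccati_blowup:
  fixes G G' :: "real \<Rightarrow> real"
  assumes "r0 > 0" "c > 0"
    and deriv: "\<And>r. r \<ge> r0 \<Longrightarrow> (G has_real_derivative G' r) (at r)"
    and mono: "\<And>r. r \<ge> r0 \<Longrightarrow> G' r \<ge> 0"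
    and ineq: "\<And>r. r \<ge> r0 \<Longrightarrow> G r > \<epsilon> \<Longrightarrow> r * G' r \<ge> c * (G r - \<epsilon>)\<^sup>2"
  shows "G r0 \<le> \<epsilon>"
proof (rule ccontr)
  assume "\<not> G r0 \<le> \<epsilon>"
  then have G0: "G r0 > \<epsilon>" by simp
  have G: "G r > \<epsilon>" if "r \<ge> r0" for r
  proof -
    have "G r0 \<le> G r"
      using that by (rule DERIV_nonneg_imp_nondecreasing) (meson deriv mono)
    then show ?thesis using G0 by simp
  qed
  define H where "H r = - (1 / (G r - \<epsilon>)) - c * ln r" for r
  have Hmono: "H r0 \<le> H r" if "r \<ge> r0" for r
  proof (rule DERIV_nonneg_imp_nondecreasing[OF that], intro exI conjI)
    fix s assume s: "r0 \<le> s" "s \<le> r"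
    have s0: "s > 0" using s assms(1) by simp
    show "(H has_real_derivative G' s / (G s - \<epsilon>)\<^sup>2 - c / s) (at s)"
      unfolding H_def using G[OF s(1)] s0
      by (auto intro!: derivative_eq_intros deriv s simp: power2_eq_square)
    have "c * (G s - \<epsilon>)\<^sup>2 \<le> s * G' s" using ineq[OF s(1) G[OF s(1)]] .
    then show "0 \<le> G' s / (G s - \<epsilon>)\<^sup>2 - c / s"
      using s0 G[OF s(1)] by (simp add: field_simps)
  qed
  have le: "H r0 \<le> - c * ln r" if "r \<ge> r0" for r
  proof -
    have "1 / (G r - \<epsilon>) > 0" using G[OF that] by simp
    then show ?thesis using Hmono[OF that] unfolding H_def[of r] by linarith
  qed
  \<comment> \<open>At this radius \<open>c * ln r\<close> is at least \<open>c - H r0\<close>,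
    whereas \<open>le\<close> allows at most \<open>- H r0\<close>.\<close>
  define r where "r = max r0 (exp (1 - H r0 / c))"
  have "ln r \<ge> ln (exp (1 - H r0 / c))" unfolding r_def
    by (intro ln_mono) auto
  then have "c * ln r \<ge> c - H r0" using \<open>c > 0\<close> by (simp add: field_simps)
  then show False using le[of r] \<open>c > 0\<close> by (simp add: r_def)
qed

section \<open>Energy identities\<close>

definition cutoff :: "real \<Rightarrow> 'a::euclidean_space \<Rightarrow> real" where
  "cutoff r x = max 0 (1 - (x \<bullet> x) / r\<^sup>2)"

lemma cutoff_nonneg: "cutoff r x \<ge> 0"
  by (simp add: cutoff_def)

lemma cutoff_le_1: "cutoff r x \<le> 1"
  by (simp add: cutoff_def)

lemma cutoff_square_le_1: "(cutoff r x)\<^sup>2 \<le> 1"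
  by (simp add: power_le_one cutoff_nonneg cutoff_le_1)

lemma cutoff_eq_0: "cutoff r x = 0" if "r > 0" "norm x \<ge> r"
proof -
  have "r\<^sup>2 \<le> x \<bullet> x" using that by (simp add: dot_square_norm power_mono)
  then show ?thesis using that(1) by (simp add: cutoff_def field_simps)
qed

lemma cutoff_pos: "cutoff r x > 0" if "norm x < r"
proof -
  have "r > 0" using that norm_ge_zero[of x] by linarith
  moreover have "x \<bullet> x < r\<^sup>2" using that by (simp add: dot_square_norm power_strict_mono)
  ultimately show ?thesis by (simp add: cutoff_def field_simps)
qed

lemma continuous_on_cutoff [continuous_intros]: "continuous_on S (cutoff r)"
  unfolding cutoff_def divide_inverse by (intro continuous_intros)

text \<open>The gradient of the squared cutoff is a multiple of \<open>x\<close> and keeps one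
  factor \<open>cutoff r x\<close>. Hence a test with it involves \<open>u\<close> only through the
  radial derivative \<open>Du x x\<close>, with a nonnegative weight, and no integrals over spheres
  arise.\<close>

lemma cutoff_square_has_derivative:
  "((\<lambda>x. (cutoff r x)\<^sup>2) has_derivative (\<lambda>h. - 4 * cutoff r x * (x \<bullet> h) / r\<^sup>2)) (at x)"
proof -
  have "((\<lambda>x. 1 - (x \<bullet> x) / r\<^sup>2) has_derivative (\<lambda>h. - 2 * (x \<bullet> h) / r\<^sup>2)) (at x)"
    by (auto intro!: derivative_eq_intros simp: inner_commute fun_eq_iff divide_inverse algebra_simps)
  from has_derivative_compose[OF this, OF DERIV_pos_part_square[unfolded has_field_derivative_def]]
  show ?thesis by (simp add: cutoff_def algebra_simps)
qed

lemma cutoff_integrable: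
  fixes f :: "'a::euclidean_space \<Rightarrow> real"
  assumes "continuous_on UNIV f" "r > 0"
  shows "integrable lborel (\<lambda>x. cutoff r x * f x)" "integrable lborel (\<lambda>x. (cutoff r x)\<^sup>2 * f x)"
  using assms by (auto intro!: integrable_continuous_supported_in_ball[where R = r] continuous_intros
      simp: cutoff_eq_0)

lemma integral_cutoff_le:
  assumes "r > 0"
  shows "(\<integral>x. cutoff r (x::'a::euclidean_space) \<partial>lborel) \<le> measure lborel (ball (0::'a) 1) * r ^ DIM('a)"
proof -
  have "(\<integral>x. cutoff r (x::'a) \<partial>lborel) \<le> (\<integral>x. indicator (ball (0::'a) r) x \<partial>lborel)"
  proof (rule integral_mono)
    show "integrable lborel (cutoff r :: 'a \<Rightarrow> real)"
      using cutoff_integrable(1)[of "\<lambda>_. 1" r] assms by simp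
    show "integrable lborel (indicator (ball (0::'a) r) :: 'a \<Rightarrow> real)"
      by (intro integrable_real_indicator) (use emeasure_lborel_ball_finite[of "0::'a" r] in auto)
    show "cutoff r x \<le> indicator (ball 0 r) x" for x :: 'a
      using cutoff_eq_0[OF assms, of x] cutoff_le_1[of r x] by (auto simp: indicator_def)
  qed
  also have "\<dots> = measure lborel (ball (0::'a) 1) * r ^ DIM('a)"
    using content_ball_conv_unit_ball[of r "0::'a"] assms by simp
  finally show ?thesis .
qed

lemma integral_cutoff_square_le:
  assumes "r > 0"
  shows "(\<integral>x. (cutoff r (x::'a::euclidean_space))\<^sup>2 \<partial>lborel) \<le> measure lborel (ball (0::'a) 1) * r ^ DIM('a)"
proof -
  have "(\<integral>x. (cutoff r (x::'a))\<^sup>2 \<partial>lborel) \<le> (\<integral>x. cutoff r (x::'a) \<partial>lborel)"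
  proof (rule integral_mono)
    show "(cutoff r x)\<^sup>2 \<le> cutoff r x" for x :: 'a
      using mult_left_mono[OF cutoff_le_1 cutoff_nonneg, of r x] by (simp add: power2_eq_square)
  qed (use cutoff_integrable[of "\<lambda>_. 1" r] assms in auto)
  also note integral_cutoff_le[OF assms]
  finally show ?thesis .
qed

section \<open>The system in coordinate-free form and its energy density\<close>

lemma euclidean_expand_blinfun:
  fixes x :: "'a::euclidean_space"
  shows "(\<Sum>b\<in>Basis. (x \<bullet> b) *\<^sub>R blinfun_apply L b) = L x"
proof -
  have "L x = L (\<Sum>b\<in>Basis. (x \<bullet> b) *\<^sub>R b)" by (simp add: euclidean_representation)
  then show ?thesis by (simp add: blinfun.sum_right blinfun.scaleR_right)
qed

text \<open>The derivatives are explicit maps into bounded linear functions, so that they can be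
  differentiated and integrated as they stand; the Laplacian becomes the trace of
  \<open>D2u x\<close>.\<close>

locale semilinear_system =
  fixes W :: "'b::euclidean_space \<Rightarrow> real" and gW :: "'b \<Rightarrow> 'b"
    and u :: "'a::euclidean_space \<Rightarrow> 'b"
    and Du :: "'a \<Rightarrow> 'a \<Rightarrow>\<^sub>L 'b" and D2u :: "'a \<Rightarrow> 'a \<Rightarrow>\<^sub>L 'a \<Rightarrow>\<^sub>L 'b"
  assumes W_deriv: "(W has_derivative (\<lambda>h. gW v \<bullet> h)) (at v)"
    and gW_cont: "continuous_on UNIV gW"
    and W_nonneg: "W v \<ge> 0"
    and u_deriv: "(u has_derivative blinfun_apply (Du x)) (at x)"
    and Du_deriv: "(Du has_derivative blinfun_apply (D2u x)) (at x)"
    and D2u_cont: "continuous_on UNIV D2u"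
    and equation: "(\<Sum>b\<in>Basis. D2u x b b) = gW (u x)"
begin

lemma W_cont: "continuous_on UNIV W"
  using W_deriv by (meson continuous_on_eq_continuous_at has_derivative_continuous open_UNIV)

lemma u_cont: "continuous_on UNIV u"
  using u_deriv by (meson continuous_on_eq_continuous_at has_derivative_continuous open_UNIV)

lemma Du_cont: "continuous_on UNIV Du"
  using Du_deriv by (meson continuous_on_eq_continuous_at has_derivative_continuous open_UNIV)

lemma Wu_cont: "continuous_on UNIV (\<lambda>x. W (u x))"
  by (rule continuous_on_compose2[OF W_cont u_cont]) auto

lemma gWu_cont: "continuous_on UNIV (\<lambda>x. gW (u x))"
  by (rule continuous_on_compose2[OF gW_cont u_cont]) auto

lemmas cont_intros = continuous_intros u_cont Du_cont D2u_cont Wu_cont gWu_cont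

text \<open>Pairing with a fixed vector \<open>w\<close> reduces the claim to real-valued
  functions.\<close>

lemma D2u_symmetric: "D2u x a b = D2u x b a"
proof (rule euclidean_eqI)
  fix w :: 'b
  have "((\<lambda>y. u y \<bullet> w) has_derivative (\<lambda>h. Du x h \<bullet> w)) (at x)" for x
    by (auto intro!: derivative_eq_intros u_deriv)
  moreover have "((\<lambda>y. Du y c \<bullet> w) has_derivative (\<lambda>h. D2u x h c \<bullet> w)) (at x)" for x c
    by (auto intro!: derivative_eq_intros Du_deriv)
  moreover have "isCont (\<lambda>y. D2u y c d \<bullet> w) x" for c d
  proof -
    have "continuous_on UNIV (\<lambda>y. D2u y c d \<bullet> w)" by (intro cont_intros)
    then show ?thesis by (simp add: continuous_on_eq_continuous_at)
  qed
  ultimately show "D2u x a b \<bullet> w = D2u x b a \<bullet> w"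
    using second_derivative_symmetric[where f = "\<lambda>y. u y \<bullet> w" and f' = "\<lambda>x h. Du x h \<bullet> w"
        and a = b and b = a and fa = "\<lambda>x h. D2u x h b \<bullet> w" and fb = "\<lambda>x h. D2u x h a \<bullet> w"] by blast
qed

text \<open>This is the squared Hilbert-Schmidt norm of \<open>Du x\<close>;
  \<open>norm (Du x)\<close> would be the operator norm.\<close>

definition grad_sq :: "'a \<Rightarrow> real" where
  "grad_sq x = (\<Sum>b\<in>Basis. Du x b \<bullet> Du x b)"

definition energy :: "'a \<Rightarrow> real" where
  "energy x = grad_sq x / 2 + W (u x)"

lemma grad_sq_nonneg: "grad_sq x \<ge> 0"
  unfolding grad_sq_def by (intro sum_nonneg) auto

lemma energy_nonneg: "energy x \<ge> 0"
  unfolding energy_def using grad_sq_nonneg[of x] W_nonneg[of "u x"] by simp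

lemma grad_sq_cont: "continuous_on UNIV grad_sq"
  unfolding grad_sq_def by (intro cont_intros)

lemma energy_cont: "continuous_on UNIV energy"
  unfolding energy_def by (intro cont_intros grad_sq_cont) auto

lemma energy_deriv:
  "(energy has_derivative (\<lambda>h. (\<Sum>c\<in>Basis. D2u x h c \<bullet> Du x c) + gW (u x) \<bullet> Du x h)) (at x)"
proof -
  have "((\<lambda>x. W (u x)) has_derivative (\<lambda>h. gW (u x) \<bullet> Du x h)) (at x)"
    by (rule has_derivative_compose[OF u_deriv W_deriv])
  moreover have "((\<lambda>x. grad_sq x / 2) has_derivative (\<lambda>h. \<Sum>c\<in>Basis. D2u x h c \<bullet> Du x c)) (at x)"
    unfolding grad_sq_def sum_divide_distrib
  proof (rule has_derivative_sum)
    fix c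
    have "((\<lambda>x. Du x c) has_derivative (\<lambda>h. D2u x h c)) (at x)"
      by (auto intro!: derivative_eq_intros Du_deriv simp: blinfun.zero_right)
    from has_derivative_inner[OF this this]
    have "((\<lambda>x. (Du x c \<bullet> Du x c) / 2) has_derivative
        (\<lambda>h. (Du x c \<bullet> D2u x h c + D2u x h c \<bullet> Du x c) / 2)) (at x)"
      by (rule bounded_linear.has_derivative[OF bounded_linear_divide])
    then show "((\<lambda>x. (Du x c \<bullet> Du x c) / 2) has_derivative (\<lambda>h. D2u x h c \<bullet> Du x c)) (at x)"
      by (simp add: inner_commute)
  qed
  ultimately show ?thesis unfolding energy_def
    by (simp add: has_derivative_add add.commute)
qed

section \<open>The Pohozaev identity and the derivative of the scaled energy\<close>

definition pohozaev_deriv :: "real \<Rightarrow> 'a \<Rightarrow> 'a \<Rightarrow> 'a \<Rightarrow> real" where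
  "pohozaev_deriv r b x h =
    - 4 * cutoff r x * (x \<bullet> h) / r\<^sup>2 * (Du x x \<bullet> Du x b - (x \<bullet> b) * energy x)
      + (cutoff r x)\<^sup>2 * ((D2u x h x + Du x h) \<bullet> Du x b + Du x x \<bullet> D2u x h b - (h \<bullet> b) * energy x
          - (x \<bullet> b) * ((\<Sum>c\<in>Basis. D2u x h c \<bullet> Du x c) + gW (u x) \<bullet> Du x h))"

text \<open>The field is the squared cutoff times the stress-energy tensor applied to the position
  vector. The divergence of the tensor itself cancels, by the symmetry of \<open>D2u\<close> and by
  the equation. There remain the terms with the gradient of the cutoff and the trace
  \<open>grad_sq x - n * energy x\<close> of the tensor, where n is the dimension; this trace equals
  \<open>- (n - 2) * energy x - 2 * W (u x)\<close>.\<close>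

lemma pohozaev_divergence:
  shows "((\<lambda>x. (cutoff r x)\<^sup>2 * (Du x x \<bullet> Du x b - (x \<bullet> b) * energy x)) has_derivative pohozaev_deriv r b x) (at x)"
    and "continuous_on UNIV (\<lambda>x. pohozaev_deriv r b x b)"
    and "(\<Sum>b\<in>Basis. pohozaev_deriv r b x b) = - 4 / r\<^sup>2 * (cutoff r x * (Du x x \<bullet> Du x x))
      + 4 / r\<^sup>2 * (cutoff r x * ((x \<bullet> x) * energy x))
      - (real DIM('a) - 2) * ((cutoff r x)\<^sup>2 * energy x) - 2 * ((cutoff r x)\<^sup>2 * W (u x))"
proof -
  show "((\<lambda>x. (cutoff r x)\<^sup>2 * (Du x x \<bullet> Du x b - (x \<bullet> b) * energy x)) has_derivative pohozaev_deriv r b x) (at x)"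
    unfolding pohozaev_deriv_def
    by (rule derivative_eq_intros cutoff_square_has_derivative Du_deriv energy_deriv refl)+
      (auto simp: fun_eq_iff algebra_simps inner_commute)
  show "continuous_on UNIV (\<lambda>x. pohozaev_deriv r b x b)"
    unfolding pohozaev_deriv_def divide_inverse by (intro cont_intros energy_cont)
  have S: "(\<Sum>b\<in>Basis. (x \<bullet> b) * (v \<bullet> Du x b)) = v \<bullet> Du x x" for v
  proof -
    have "v \<bullet> Du x x = v \<bullet> (\<Sum>b\<in>Basis. (x \<bullet> b) *\<^sub>R Du x b)" by (simp add: euclidean_expand_blinfun)
    then show ?thesis by (simp add: inner_sum_right)
  qed
  have xx: "(\<Sum>b\<in>Basis. (x \<bullet> b) * (x \<bullet> b)) = x \<bullet> x"
    by (simp add: euclidean_inner[of x x])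
  \<comment> \<open>By symmetry, the derivative of \<open>Du x c\<close> along the position vector
    becomes the second-order term that arises when \<open>Du x x\<close> is differentiated along
    \<open>c\<close>. The two cancel in \<open>sum R Basis\<close>.\<close>
  have D2x: "(\<Sum>b\<in>Basis. (x \<bullet> b) * (D2u x b c \<bullet> Du x c)) = D2u x c x \<bullet> Du x c" for c
  proof -
    have "D2u x x c = (\<Sum>b\<in>Basis. (x \<bullet> b) *\<^sub>R D2u x b) c" by (simp add: euclidean_expand_blinfun)
    then have "D2u x c x = (\<Sum>b\<in>Basis. (x \<bullet> b) *\<^sub>R D2u x b c)"
      by (simp add: D2u_symmetric[of x c x] blinfun.sum_left blinfun.scaleR_left)
    then show ?thesis by (simp add: inner_sum_left)
  qed
  have D2e: "(\<Sum>b\<in>Basis. (x \<bullet> b) * (\<Sum>c\<in>Basis. D2u x b c \<bullet> Du x c)) = (\<Sum>c\<in>Basis. D2u x c x \<bullet> Du x c)"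
    unfolding sum_distrib_left by (subst sum.swap) (simp add: D2x)
  have lap: "(\<Sum>b\<in>Basis. Du x x \<bullet> D2u x b b) = Du x x \<bullet> gW (u x)"
    by (simp add: equation[symmetric] inner_sum_right)
  \<comment> \<open>\<open>P\<close> collects the terms in which the cutoff was differentiated,
    \<open>R\<close> those in which it was not.\<close>
  define P where "P b = (x \<bullet> b) * (Du x x \<bullet> Du x b) - ((x \<bullet> b) * (x \<bullet> b)) * energy x" for b
  define R where "R b = D2u x b x \<bullet> Du x b + Du x b \<bullet> Du x b + Du x x \<bullet> D2u x b b - energy x
      - (x \<bullet> b) * (\<Sum>c\<in>Basis. D2u x b c \<bullet> Du x c) - (x \<bullet> b) * (gW (u x) \<bullet> Du x b)" for b
  have "pohozaev_deriv r b x b = - 4 * cutoff r x / r\<^sup>2 * P b + (cutoff r x)\<^sup>2 * R b" if "b \<in> Basis" for b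
    using that unfolding pohozaev_deriv_def P_def R_def by (simp add: algebra_simps inner_Basis add_divide_distrib diff_divide_distrib)
  then have "(\<Sum>b\<in>Basis. pohozaev_deriv r b x b)
      = (\<Sum>b\<in>Basis. - 4 * cutoff r x / r\<^sup>2 * P b + (cutoff r x)\<^sup>2 * R b)"
    by (intro sum.cong) auto
  then have "(\<Sum>b\<in>Basis. pohozaev_deriv r b x b) = - 4 * cutoff r x / r\<^sup>2 * sum P Basis + (cutoff r x)\<^sup>2 * sum R Basis"
    by (simp only: sum.distrib sum_distrib_left)
  moreover have "sum P Basis = Du x x \<bullet> Du x x - (x \<bullet> x) * energy x"
    unfolding P_def sum_subtractf S sum_distrib_right[symmetric] xx ..
  moreover have "sum R Basis = grad_sq x - real DIM('a) * energy x"
    unfolding R_def sum_subtractf sum.distrib S D2e lap by (simp add: grad_sq_def inner_commute)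
  moreover have "grad_sq x = 2 * energy x - 2 * W (u x)" by (simp add: energy_def)
  ultimately show "(\<Sum>b\<in>Basis. pohozaev_deriv r b x b) = - 4 / r\<^sup>2 * (cutoff r x * (Du x x \<bullet> Du x x))
      + 4 / r\<^sup>2 * (cutoff r x * ((x \<bullet> x) * energy x))
      - (real DIM('a) - 2) * ((cutoff r x)\<^sup>2 * energy x) - 2 * ((cutoff r x)\<^sup>2 * W (u x))"
    by (simp add: algebra_simps)
qed

text \<open>\<open>Du x x\<close> is \<open>norm x\<close> times the radial derivative of
  \<open>u\<close>, so this is j(r) without its factor r^(-n).\<close>

definition radial :: "real \<Rightarrow> real" where
  "radial r = (\<integral>x. cutoff r x * (Du x x \<bullet> Du x x) \<partial>lborel)"

definition potential_mass :: "real \<Rightarrow> real" where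
  "potential_mass r = (\<integral>x. (cutoff r x)\<^sup>2 * W (u x) \<partial>lborel)"

definition energy_mass :: "real \<Rightarrow> real" where
  "energy_mass r = (\<integral>x. (cutoff r x)\<^sup>2 * energy x \<partial>lborel)"

text \<open>The divergence just computed belongs to a field supported in the ball of radius
  \<open>r\<close>, so its integral is zero. The left-hand side is \<open>r\<close> times the
  derivative of \<open>energy_mass\<close> at \<open>r\<close>.\<close>

lemma pohozaev_identity:
  assumes "r > 0"
  shows "4 / r\<^sup>2 * (\<integral>x. cutoff r x * ((x \<bullet> x) * energy x) \<partial>lborel)
    = (real DIM('a) - 2) * energy_mass r + 2 * potential_mass r + 4 / r\<^sup>2 * radial r"
proof -
  note int = cutoff_integrable[OF _ assms]
  have int': "integrable lborel (\<lambda>x. cutoff r x * (Du x x \<bullet> Du x x))"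
    "integrable lborel (\<lambda>x. cutoff r x * ((x \<bullet> x) * energy x))"
    "integrable lborel (\<lambda>x. (cutoff r x)\<^sup>2 * energy x)"
    "integrable lborel (\<lambda>x. (cutoff r x)\<^sup>2 * W (u x))"
    by (intro int cont_intros energy_cont)+
  have zero: "(\<integral>x. - 4 / r\<^sup>2 * (cutoff r x * (Du x x \<bullet> Du x x))
      + 4 / r\<^sup>2 * (cutoff r x * ((x \<bullet> x) * energy x))
      - (real DIM('a) - 2) * ((cutoff r x)\<^sup>2 * energy x) - 2 * ((cutoff r x)\<^sup>2 * W (u x)) \<partial>lborel) = 0"
    unfolding pohozaev_divergence(3)[symmetric]
    by (rule integral_divergence_eq_0[OF pohozaev_divergence(1,2), where R = r])
      (simp add: cutoff_eq_0 assms)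
  have eq: "(\<integral>x. A * (cutoff r x * (Du x x \<bullet> Du x x)) + B * (cutoff r x * ((x \<bullet> x) * energy x))
      - C * ((cutoff r x)\<^sup>2 * energy x) - D * ((cutoff r x)\<^sup>2 * W (u x)) \<partial>lborel)
    = A * radial r + B * (\<integral>x. cutoff r x * ((x \<bullet> x) * energy x) \<partial>lborel)
      - C * energy_mass r - D * potential_mass r" for A B C D
    using int' by (simp add: energy_mass_def potential_mass_def radial_def)
  show ?thesis using zero unfolding eq by simp
qed

lemma energy_mass_deriv:
  assumes "r > 0"
  shows "(energy_mass has_real_derivative
    4 / r ^ 3 * (\<integral>x. cutoff r x * ((x \<bullet> x) * energy x) \<partial>lborel)) (at r)"
proof -
  \<comment> \<open>The Leibniz rule needs a domain that does not move with the radius: this box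
    contains the supports of \<open>cutoff s\<close> for all \<open>s\<close> in
    \<open>U\<close>.\<close>
  obtain a :: 'a where a: "cball 0 (r + 1) \<subseteq> cbox (- a) a"
    using bounded_subset_cbox_symmetric[OF bounded_cball] by blast
  define U where "U = {0<..<r + 1}"
  define f where "f s x = (cutoff s x)\<^sup>2 * energy x" for s x
  define f' where "f' s x = 4 / s ^ 3 * (cutoff s x * ((x \<bullet> x) * energy x))" for s x
  have to_box: "integral\<^sup>L lborel g = integral (cbox (- a) a) g"
    if "continuous_on UNIV g" "\<And>x. norm x \<ge> r + 1 \<Longrightarrow> g x = 0" for g :: "'a \<Rightarrow> real"
  proof -
    have "integrable lborel g"
      by (rule integrable_continuous_supported_in_ball[OF that])
    then have "integral\<^sup>L lborel g = integral UNIV g"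
      by (rule integral_lborel[symmetric])
    also have "integral UNIV g = integral UNIV (\<lambda>x. if x \<in> cbox (- a) a then g x else 0)"
      using that(2) a by (intro arg_cong[of _ _ "integral UNIV"]) (auto simp: fun_eq_iff subset_eq)
    also have "\<dots> = integral (cbox (- a) a) g"
      by (rule integral_restrict_UNIV)
    finally show ?thesis .
  qed
  have "((\<lambda>s. integral (cbox (- a) a) (f s)) has_real_derivative integral (cbox (- a) a) (f' r)) (at r within U)"
  proof (rule leibniz_rule_field_derivative)
    fix s and x :: 'a assume s: "s \<in> U"
    have s0: "s \<noteq> 0" using s by (simp add: U_def)
    have "((\<lambda>s. 1 - (x \<bullet> x) / s\<^sup>2) has_real_derivative 2 * (x \<bullet> x) / s ^ 3) (at s)"
      using s0 by (auto intro!: derivative_eq_intros simp: field_simps power2_eq_square power3_eq_cube)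
    from DERIV_chain2[OF DERIV_pos_part_square this]
    have "((\<lambda>s. (cutoff s x)\<^sup>2) has_real_derivative 2 * cutoff s x * (2 * (x \<bullet> x) / s ^ 3)) (at s)"
      by (simp add: cutoff_def)
    from DERIV_cmult_right[OF this, of "energy x"]
    have "((\<lambda>s. f s x) has_real_derivative f' s x) (at s)"
      unfolding f_def f'_def by (simp add: algebra_simps)
    then show "((\<lambda>s. f s x) has_real_derivative f' s x) (at s within U)"
      by (rule has_field_derivative_at_within)
  next
    fix s show "f s integrable_on cbox (- a) a"
      unfolding f_def by (intro integrable_continuous continuous_intros continuous_on_subset[OF energy_cont]) auto
  next
    show "continuous_on (U \<times> cbox (- a) a) (\<lambda>(s, x). f' s x)"
      unfolding f'_def cutoff_def split_beta
      by (intro continuous_intros continuous_on_compose2[OF energy_cont]) (auto simp: U_def)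
  qed (use assms in \<open>auto simp: U_def\<close>)
  then have "((\<lambda>s. integral (cbox (- a) a) (f s)) has_real_derivative integral (cbox (- a) a) (f' r)) (at r)"
    using assms by (subst (asm) at_within_open[of r U]) (auto simp: U_def)
  moreover have "integral (cbox (- a) a) (f' r) = 4 / r ^ 3 * (\<integral>x. cutoff r x * ((x \<bullet> x) * energy x) \<partial>lborel)"
  proof -
    have "integral (cbox (- a) a) (f' r) = integral\<^sup>L lborel (f' r)"
      using assms unfolding f'_def
      by (intro to_box[symmetric] continuous_intros energy_cont) (auto simp: cutoff_eq_0)
    also have "\<dots> = 4 / r ^ 3 * (\<integral>x. cutoff r x * ((x \<bullet> x) * energy x) \<partial>lborel)"
      unfolding f'_def by (rule Bochner_Integration.integral_mult_right_zero)
    finally show ?thesis .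
  qed
  moreover have "energy_mass s = integral (cbox (- a) a) (f s)" if "s \<in> U" for s
    using that unfolding energy_mass_def f_def U_def
    by (intro to_box continuous_intros energy_cont) (auto simp: cutoff_eq_0)
  ultimately show ?thesis
    using assms
    by (auto intro: has_field_derivative_transform_within_open[where S = U] simp: U_def)
qed

text \<open>The factor r^(2-n) is a quotient of natural powers, which avoids truncated subtraction
  in the exponent.\<close>

definition scaled_energy :: "real \<Rightarrow> real" where
  "scaled_energy r = r\<^sup>2 / r ^ DIM('a) * energy_mass r"

text \<open>Differentiating the prefactor produces \<open>2 - n\<close> times the energy, and the
  Pohozaev identity cancels exactly this term. What is left is nonnegative, which is the
  monotonicity formula.\<close>

lemma scaled_energy_deriv:
  assumes "r > 0"
  shows "(scaled_energy has_real_derivative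
    2 * r / r ^ DIM('a) * (potential_mass r + 2 / r\<^sup>2 * radial r)) (at r)"
proof -
  obtain m where m: "DIM('a) = Suc m" using DIM_positive[where 'a = 'a] gr0_implies_Suc by blast
  define I where "I = (\<integral>x. cutoff r x * ((x \<bullet> x) * energy x) \<partial>lborel)"
  have I: "4 / r\<^sup>2 * I = (real DIM('a) - 2) * energy_mass r + 2 * potential_mass r + 4 / r\<^sup>2 * radial r"
    unfolding I_def by (rule pohozaev_identity[OF assms])
  have "((\<lambda>r. r\<^sup>2 / r ^ DIM('a)) has_real_derivative (2 - real DIM('a)) * (r / r ^ DIM('a))) (at r)"
    by (rule DERIV_cong[OF DERIV_divide[OF DERIV_power[OF DERIV_ident] DERIV_power[OF DERIV_ident]]])
      (use assms in \<open>auto simp: m field_simps power2_eq_square\<close>)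
  from DERIV_mult[OF this energy_mass_deriv[OF assms]]
  have "(scaled_energy has_real_derivative (2 - real DIM('a)) * (r / r ^ DIM('a)) * energy_mass r
      + 4 / r ^ 3 * I * (r\<^sup>2 / r ^ DIM('a))) (at r)"
    unfolding scaled_energy_def I_def .
  moreover have "4 / r ^ 3 * I * (r\<^sup>2 / r ^ DIM('a)) = (r / r ^ DIM('a)) * (4 / r\<^sup>2 * I)"
    using assms by (simp add: field_simps power2_eq_square power3_eq_cube)
  ultimately show ?thesis unfolding I by (simp add: algebra_simps)
qed

section \<open>The Caccioppoli identity and the upper bound for the energy\<close>

lemma caccioppoli_identity:
  assumes "r > 0"
  shows "(\<integral>x. (cutoff r x)\<^sup>2 * grad_sq x \<partial>lborel)
    = (\<integral>x. (cutoff r x)\<^sup>2 * (- ((u x - Q) \<bullet> gW (u x))) \<partial>lborel)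
      + 4 / r\<^sup>2 * (\<integral>x. cutoff r x * ((u x - Q) \<bullet> Du x x) \<partial>lborel)"
proof -
  \<comment> \<open>These are the components of the squared cutoff times the gradient of half the
    squared distance from \<open>u\<close> to \<open>Q\<close>. In the divergence the equation
    replaces the Laplacian of \<open>u\<close> by \<open>gW (u x)\<close>.\<close>
  define f where "f b x = (cutoff r x)\<^sup>2 * ((u x - Q) \<bullet> Du x b)" for b x
  define f' where "f' b x h = - 4 * cutoff r x * (x \<bullet> h) / r\<^sup>2 * ((u x - Q) \<bullet> Du x b)
      + (cutoff r x)\<^sup>2 * (Du x h \<bullet> Du x b + (u x - Q) \<bullet> D2u x h b)" for b x h
  have "(f b has_derivative f' b x) (at x)" for b x
    unfolding f_def f'_def
    by (rule derivative_eq_intros cutoff_square_has_derivative Du_deriv u_deriv refl)+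
      (auto simp: fun_eq_iff algebra_simps)
  moreover have "continuous_on UNIV (\<lambda>x. f' b x b)" for b
    unfolding f'_def divide_inverse by (intro cont_intros)
  ultimately have zero: "(\<integral>x. (\<Sum>b\<in>Basis. f' b x b) \<partial>lborel) = 0"
    by (rule integral_divergence_eq_0[where R = r]) (simp add: f_def cutoff_eq_0 assms)
  have sum: "(\<Sum>b\<in>Basis. f' b x b) = - 4 / r\<^sup>2 * (cutoff r x * ((u x - Q) \<bullet> Du x x))
      + (cutoff r x)\<^sup>2 * grad_sq x - (cutoff r x)\<^sup>2 * (- ((u x - Q) \<bullet> gW (u x)))" for x
  proof -
    have "(\<Sum>b\<in>Basis. f' b x b) = - 4 * cutoff r x / r\<^sup>2 * ((u x - Q) \<bullet> (\<Sum>b\<in>Basis. (x \<bullet> b) *\<^sub>R Du x b))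
      + (cutoff r x)\<^sup>2 * (grad_sq x + (u x - Q) \<bullet> (\<Sum>b\<in>Basis. D2u x b b))"
      unfolding f'_def grad_sq_def inner_sum_right sum.distrib[symmetric] sum_distrib_left
      by (intro sum.cong) (auto simp: algebra_simps add_divide_distrib diff_divide_distrib)
    then show ?thesis unfolding euclidean_expand_blinfun equation
      by (simp add: algebra_simps add_divide_distrib diff_divide_distrib)
  qed
  have eq: "(\<integral>x. A * (cutoff r x * ((u x - Q) \<bullet> Du x x))
      + (cutoff r x)\<^sup>2 * grad_sq x - (cutoff r x)\<^sup>2 * (- ((u x - Q) \<bullet> gW (u x))) \<partial>lborel)
    = A * (\<integral>x. cutoff r x * ((u x - Q) \<bullet> Du x x) \<partial>lborel)
      + (\<integral>x. (cutoff r x)\<^sup>2 * grad_sq x \<partial>lborel)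
      - (\<integral>x. (cutoff r x)\<^sup>2 * (- ((u x - Q) \<bullet> gW (u x))) \<partial>lborel)" for A
  proof -
    have "integrable lborel (\<lambda>x. cutoff r x * ((u x - Q) \<bullet> Du x x))"
      "integrable lborel (\<lambda>x. (cutoff r x)\<^sup>2 * grad_sq x)"
      "integrable lborel (\<lambda>x. (cutoff r x)\<^sup>2 * (- ((u x - Q) \<bullet> gW (u x))))"
      by (intro cutoff_integrable cont_intros grad_sq_cont assms)+
    then show ?thesis
      by (subst Bochner_Integration.integral_diff, simp, simp) simp
  qed
  show ?thesis using zero unfolding sum eq by simp
qed

definition power_mass :: "real \<Rightarrow> real \<Rightarrow> real" where
  "power_mass a r = (\<integral>x. (cutoff r x)\<^sup>2 * W (u x) powr a \<partial>lborel)"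

lemma Wu_powr_cont: "a > 0 \<Longrightarrow> continuous_on S (\<lambda>x. W (u x) powr a)"
  by (intro continuous_on_powr' continuous_on_subset[OF Wu_cont] continuous_intros) (auto simp: W_nonneg)

text \<open>In the Caccioppoli identity the growth condition bounds the term with \<open>gW\<close>
  from above. The cutoff term is split by Cauchy-Schwarz, the bound \<open>M\<close> and Young's
  inequality with weight \<open>d\<close>, which stays free so that it can later be adapted to the
  size of the energy.\<close>

lemma energy_mass_le:
  assumes r: "r > 0" and d: "d > 0" and M: "\<And>x. norm (u x - Q) \<le> M"
    and a: "a > 0" and growth: "\<And>v. - ((v - Q) \<bullet> gW v) \<le> C * W v powr a"
  shows "energy_mass r \<le> C / 2 * power_mass a r + potential_mass r
    + M / r\<^sup>2 * (d * (measure lborel (ball (0::'a) 1) * r ^ DIM('a)) + radial r / d)"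
proof -
  have M0: "M \<ge> 0" using M[of 0] norm_ge_zero order_trans by blast
  note int = cutoff_integrable[OF _ r]
  have "(\<integral>x. (cutoff r x)\<^sup>2 * (- ((u x - Q) \<bullet> gW (u x))) \<partial>lborel)
      \<le> (\<integral>x. C * ((cutoff r x)\<^sup>2 * W (u x) powr a) \<partial>lborel)"
  proof (rule integral_mono)
    show "integrable lborel (\<lambda>x. (cutoff r x)\<^sup>2 * (- ((u x - Q) \<bullet> gW (u x))))"
      by (intro int cont_intros)
    show "integrable lborel (\<lambda>x. C * ((cutoff r x)\<^sup>2 * W (u x) powr a))"
      by (intro integrable_mult_right int Wu_powr_cont a)
    show "(cutoff r x)\<^sup>2 * (- ((u x - Q) \<bullet> gW (u x))) \<le> C * ((cutoff r x)\<^sup>2 * W (u x) powr a)" for x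
      using mult_left_mono[OF growth[of "u x"], of "(cutoff r x)\<^sup>2"] by (simp add: mult.left_commute)
  qed
  then have A: "(\<integral>x. (cutoff r x)\<^sup>2 * (- ((u x - Q) \<bullet> gW (u x))) \<partial>lborel) \<le> C * power_mass a r"
    unfolding power_mass_def by simp
  have "(\<integral>x. cutoff r x * ((u x - Q) \<bullet> Du x x) \<partial>lborel)
      \<le> (\<integral>x. M * d / 2 * cutoff r x + M / (2 * d) * (cutoff r x * (Du x x \<bullet> Du x x)) \<partial>lborel)"
  proof (rule integral_mono)
    show "integrable lborel (\<lambda>x. cutoff r x * ((u x - Q) \<bullet> Du x x))"
      by (intro int cont_intros)
    have "integrable lborel (\<lambda>x. cutoff r x * 1 :: real)" "integrable lborel (\<lambda>x. cutoff r x * (Du x x \<bullet> Du x x))"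
      by (intro int cont_intros)+
    then show "integrable lborel (\<lambda>x. M * d / 2 * cutoff r x + M / (2 * d) * (cutoff r x * (Du x x \<bullet> Du x x)))"
      by (intro Bochner_Integration.integrable_add integrable_mult_right) auto
    fix x
    have "(u x - Q) \<bullet> Du x x \<le> norm (u x - Q) * norm (Du x x)"
      by (rule norm_cauchy_schwarz)
    also have "\<dots> \<le> M * norm (Du x x)"
      by (intro mult_right_mono M) auto
    also have "\<dots> \<le> M * (d / 2 + (Du x x \<bullet> Du x x) / (2 * d))"
    proof (intro mult_left_mono M0)
      have "0 \<le> (norm (Du x x) - d)\<^sup>2" by simp
      then show "norm (Du x x) \<le> d / 2 + (Du x x \<bullet> Du x x) / (2 * d)"
        using d by (simp add: dot_square_norm field_simps power2_eq_square)
    qed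
    finally have "cutoff r x * ((u x - Q) \<bullet> Du x x)
        \<le> cutoff r x * (M * (d / 2 + (Du x x \<bullet> Du x x) / (2 * d)))"
      by (rule mult_left_mono[OF _ cutoff_nonneg])
    then show "cutoff r x * ((u x - Q) \<bullet> Du x x)
        \<le> M * d / 2 * cutoff r x + M / (2 * d) * (cutoff r x * (Du x x \<bullet> Du x x))"
      by (simp add: algebra_simps)
  qed
  also have "\<dots> = M * d / 2 * (\<integral>x. cutoff r (x::'a) \<partial>lborel) + M / (2 * d) * radial r"
  proof -
    have "integrable lborel (\<lambda>x. cutoff r x * 1 :: real)" "integrable lborel (\<lambda>x. cutoff r x * (Du x x \<bullet> Du x x))"
      by (intro int cont_intros)+
    then have "(\<integral>x. A * cutoff r x + B * (cutoff r x * (Du x x \<bullet> Du x x)) \<partial>lborel)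
        = A * (\<integral>x. cutoff r (x::'a) \<partial>lborel) + B * radial r" for A B
      unfolding radial_def
      by (subst Bochner_Integration.integral_add) (auto intro!: integrable_mult_right)
    then show ?thesis .
  qed
  also have "\<dots> \<le> M * d / 2 * (measure lborel (ball (0::'a) 1) * r ^ DIM('a)) + M / (2 * d) * radial r"
    using M0 d by (intro add_right_mono mult_left_mono integral_cutoff_le r) auto
  also have "\<dots> = M / 2 * (d * (measure lborel (ball (0::'a) 1) * r ^ DIM('a)) + radial r / d)"
    using d by (simp add: field_simps)
  finally have B: "4 / r\<^sup>2 * (\<integral>x. cutoff r x * ((u x - Q) \<bullet> Du x x) \<partial>lborel)
      \<le> 4 / r\<^sup>2 * (M / 2 * (d * (measure lborel (ball (0::'a) 1) * r ^ DIM('a)) + radial r / d))"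
    by (rule mult_left_mono) simp
  have "energy_mass r = (\<integral>x. (cutoff r x)\<^sup>2 * grad_sq x / 2 + (cutoff r x)\<^sup>2 * W (u x) \<partial>lborel)"
    unfolding energy_mass_def energy_def by (simp add: distrib_left)
  also have "\<dots> = (\<integral>x. (cutoff r x)\<^sup>2 * grad_sq x \<partial>lborel) / 2 + potential_mass r"
  proof -
    have "integrable lborel (\<lambda>x. (cutoff r x)\<^sup>2 * grad_sq x)" "integrable lborel (\<lambda>x. (cutoff r x)\<^sup>2 * W (u x))"
      by (intro int cont_intros grad_sq_cont)+
    then show ?thesis by (simp add: potential_mass_def)
  qed
  also have "\<dots> \<le> (C * power_mass a r
      + 4 / r\<^sup>2 * (M / 2 * (d * (measure lborel (ball (0::'a) 1) * r ^ DIM('a)) + radial r / d))) / 2 + potential_mass r"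
    unfolding caccioppoli_identity[OF r, of Q] using A B by simp
  also have "\<dots> = C / 2 * power_mass a r + potential_mass r
    + M / r\<^sup>2 * (d * (measure lborel (ball (0::'a) 1) * r ^ DIM('a)) + radial r / d)"
    using r by (simp add: field_simps)
  finally show ?thesis .
qed

section \<open>Monotonicity, the blow-up argument and the Liouville theorem\<close>

lemma masses_nonneg: "radial r \<ge> 0" "potential_mass r \<ge> 0" "energy_mass r \<ge> 0"
  unfolding radial_def potential_mass_def energy_mass_def
  by (auto intro!: integral_nonneg_AE AE_I2 simp: cutoff_nonneg W_nonneg energy_nonneg)

lemma scaled_energy_mono:
  assumes "0 < r" "r \<le> s"
  shows "scaled_energy r \<le> scaled_energy s"
proof (rule DERIV_nonneg_imp_nondecreasing[OF assms(2)])
  fix t assume "r \<le> t" "t \<le> s"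
  then have "t > 0" using assms by simp
  moreover have "0 \<le> 2 * t / t ^ DIM('a) * (potential_mass t + 2 / t\<^sup>2 * radial t)"
    using \<open>t > 0\<close> masses_nonneg[of t] by simp
  ultimately show "\<exists>y. (scaled_energy has_real_derivative y) (at t) \<and> 0 \<le> y"
    using scaled_energy_deriv by blast
qed

text \<open>With \<open>d\<close> proportional to the excess of the scaled energy over
  \<open>\<epsilon>\<close>, the bound of \<open>energy_mass_le\<close> says that j(r) controls the
  square of this excess. The derivative formula bounds \<open>r\<close> times the derivative below
  by 4 j(r), so \<open>riccati_blowup\<close> applies.\<close>

lemma scaled_energy_eventually_le:
  assumes bdd: "bounded (range u)" and a: "a > 0"
    and growth: "\<And>v. - ((v - Q) \<bullet> gW v) \<le> C * W v powr a"
    and r0: "r0 > 0"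
    and small: "\<And>r. r \<ge> r0 \<Longrightarrow> r\<^sup>2 / r ^ DIM('a) * (C / 2 * power_mass a r + potential_mass r) \<le> \<epsilon>"
  shows "scaled_energy r0 \<le> \<epsilon>"
proof -
  have "bounded (range (\<lambda>x. u x - Q))"
    using bounded_minus_comp[OF bdd, of "\<lambda>_. Q"] by (simp add: image_image)
  then obtain M where M0: "M > 0" and M: "\<And>x. norm (u x - Q) \<le> M"
    by (auto simp: bounded_pos)
  define V where "V = measure lborel (ball (0::'a) 1)"
  \<comment> \<open>One constant dominates both \<open>M * V\<close> and \<open>M\<close>; the
    summand 1 also ensures \<open>M \<le> K\<close>.\<close>
  define K where "K = M * (V + 1)"
  have K: "K > 0" "M * V \<le> K" "M \<le> K" using M0 by (auto simp: K_def V_def add_nonneg_pos algebra_simps)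
  show ?thesis
  proof (rule riccati_blowup[OF r0 _ scaled_energy_deriv])
    show "1 / K\<^sup>2 > 0" using K by simp
    fix r assume "r0 \<le> r"
    then have r: "r > 0" using r0 by simp
    then show "r > 0" .
    show "0 \<le> 2 * r / r ^ DIM('a) * (potential_mass r + 2 / r\<^sup>2 * radial r)"
      using r masses_nonneg[of r] by simp
    define j where "j = radial r / r ^ DIM('a)"
    have j: "j \<ge> 0" using r masses_nonneg[of r] by (simp add: j_def)
    assume "scaled_energy r > \<epsilon>"
    define g where "g = scaled_energy r - \<epsilon>"
    have g: "g > 0" using \<open>scaled_energy r > \<epsilon>\<close> by (simp add: g_def)
    \<comment> \<open>With this choice \<open>K * d\<close> is half of \<open>g\<close> and is
      absorbed on the left, which leaves \<open>g\<^sup>2 \<le> 4 * K\<^sup>2 * j\<close>.\<close>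
    define d where "d = g / (2 * K)"
    have d: "d > 0" using g K by (simp add: d_def)
    have "scaled_energy r \<le> r\<^sup>2 / r ^ DIM('a) * (C / 2 * power_mass a r + potential_mass r
        + M / r\<^sup>2 * (d * (V * r ^ DIM('a)) + radial r / d))"
      unfolding scaled_energy_def V_def using r
      by (intro mult_left_mono energy_mass_le[OF r d M a growth]) auto
    also have "\<dots> = r\<^sup>2 / r ^ DIM('a) * (C / 2 * power_mass a r + potential_mass r) + (M * V * d + M * (j / d))"
      using r d by (simp add: j_def field_simps)
    also have "\<dots> \<le> \<epsilon> + (K * d + K * (j / d))"
      using j d K by (intro add_mono small \<open>r0 \<le> r\<close> mult_right_mono) auto
    finally have "g \<le> K * d + K * (j / d)" by (simp add: g_def)
    also have "K * d = g / 2" using K by (simp add: d_def)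
    also have "K * (j / d) = 2 * K\<^sup>2 * j / g"
      using K g by (simp add: d_def field_simps power2_eq_square)
    finally have "g \<le> g / 2 + 2 * K\<^sup>2 * j / g" .
    then have "g\<^sup>2 \<le> 4 * K\<^sup>2 * j" using g by (simp add: field_simps power2_eq_square)
    then have "1 / K\<^sup>2 * g\<^sup>2 \<le> 4 * j" using K by (simp add: field_simps)
    also have "4 * j \<le> r * (2 * r / r ^ DIM('a) * (potential_mass r + 2 / r\<^sup>2 * radial r))"
    proof -
      have "r * (2 * r / r ^ DIM('a) * (potential_mass r + 2 / r\<^sup>2 * radial r))
          = 2 * r\<^sup>2 / r ^ DIM('a) * potential_mass r + 4 * j"
        using r by (simp add: j_def field_simps power2_eq_square)
      then show ?thesis using r masses_nonneg[of r] by simp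
    qed
    finally show "1 / K\<^sup>2 * (scaled_energy r - \<epsilon>)\<^sup>2
        \<le> r * (2 * r / r ^ DIM('a) * (potential_mass r + 2 / r\<^sup>2 * radial r))"
      by (simp add: g_def)
  qed
qed

text \<open>For every positive \<open>\<epsilon>\<close> the scaled energy is at most
  \<open>\<epsilon>\<close> at all large radii, and monotonicity carries this bound down to every
  radius. Hence the energy vanishes on every ball, and since both of its summands are nonnegative,
  so does \<open>Du\<close>.\<close>

theorem liouville:
  assumes bdd: "bounded (range u)" and a: "a > 0"
    and growth: "\<And>v. - ((v - Q) \<bullet> gW v) \<le> C * W v powr a"
    and pot: "((\<lambda>r. r\<^sup>2 / r ^ DIM('a) * potential_mass r) \<longlongrightarrow> 0) at_top"
    and power: "((\<lambda>r. r\<^sup>2 / r ^ DIM('a) * power_mass a r) \<longlongrightarrow> 0) at_top"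
  shows "u constant_on UNIV"
proof -
  have lim: "((\<lambda>r. r\<^sup>2 / r ^ DIM('a) * (C / 2 * power_mass a r + potential_mass r)) \<longlongrightarrow> 0) at_top"
    using tendsto_add[OF tendsto_mult[OF tendsto_const[of "C / 2"] power] pot]
    by (simp add: algebra_simps)
  have le: "scaled_energy r \<le> \<epsilon>" if r: "r > 0" and \<epsilon>: "\<epsilon> > 0" for r \<epsilon>
  proof -
    have "\<forall>\<^sub>F r in at_top. r\<^sup>2 / r ^ DIM('a) * (C / 2 * power_mass a r + potential_mass r) < \<epsilon>"
      using order_tendstoD(2)[OF lim \<epsilon>] .
    then obtain R where R: "\<And>r. r \<ge> R \<Longrightarrow> r\<^sup>2 / r ^ DIM('a) * (C / 2 * power_mass a r + potential_mass r) < \<epsilon>"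
      by (auto simp: eventually_at_top_linorder)
    have "scaled_energy r \<le> scaled_energy (max r R)"
      using r by (intro scaled_energy_mono) auto
    also have "\<dots> \<le> \<epsilon>"
      using r R by (intro scaled_energy_eventually_le[OF bdd a growth]) (auto intro: less_imp_le)
    finally show ?thesis .
  qed
  have energy0: "energy x = 0" for x
  proof -
    define r where "r = norm x + 1"
    have r: "r > 0" using norm_ge_zero[of x] unfolding r_def by linarith
    have "scaled_energy r \<le> 0" using le[OF r] by (rule field_le_epsilon[of _ 0, simplified])
    moreover have "r\<^sup>2 / r ^ DIM('a) > 0" using r by simp
    ultimately have "energy_mass r \<le> 0" unfolding scaled_energy_def mult_le_0_iff by linarith
    then have "energy_mass r = 0" using masses_nonneg(3)[of r] by simp
    moreover have c: "continuous_on UNIV (\<lambda>x. (cutoff r x)\<^sup>2 * energy x)"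
      by (intro continuous_intros energy_cont)
    moreover have "integrable lborel (\<lambda>x. (cutoff r x)\<^sup>2 * energy x)"
      by (intro cutoff_integrable energy_cont r)
    ultimately have "(cutoff r x)\<^sup>2 * energy x = 0"
      using continuous_nonneg_integral_eq_0[of "\<lambda>x. (cutoff r x)\<^sup>2 * energy x" x]
      by (simp add: energy_nonneg energy_mass_def)
    then show ?thesis using cutoff_pos[of x r] by (simp add: r_def)
  qed
  have "Du x b = 0" if "b \<in> Basis" for x b
  proof -
    have "grad_sq x = 0" using energy0[of x] grad_sq_nonneg[of x] W_nonneg[of "u x"] by (simp add: energy_def)
    then show ?thesis using that unfolding grad_sq_def by (subst (asm) sum_nonneg_eq_0_iff) auto
  qed
  then have "Du x = 0" for x by (intro blinfun_euclidean_eqI) simp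
  then have "(u has_derivative (\<lambda>h. 0)) (at x)" for x using u_deriv[of x] by (simp add: zero_blinfun.rep_eq)
  then obtain c where "\<And>x. u x = c"
    using has_derivative_zero_constant[of UNIV u] by auto
  then show ?thesis by (auto simp: constant_on_def)
qed

end

section \<open>Decay of the potential terms\<close>

text \<open>This is Young's inequality for \<open>l * t\<close> and \<open>l powr (1 - p)\<close>
  with weights \<open>(p - 1) / p\<close> and \<open>1 / p\<close>, chosen so that the powers of
  \<open>l\<close> cancel on the left. The parameter \<open>l\<close> will depend on the radius to
  balance the two terms.\<close>

lemma powr_le_linear:
  fixes t l p :: real
  assumes "t \<ge> 0" "l > 0" "p > 1"
  shows "t powr ((p - 1) / p) \<le> (p - 1) / p * l * t + l powr (1 - p) / p"
proof (cases "t = 0")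
  case True
  then show ?thesis using assms by simp
next
  case False
  then have t: "t > 0" using assms(1) by simp
  have "(l * t) powr ((p - 1) / p) * (l powr (1 - p)) powr (1 / p)
      \<le> (p - 1) / p * (l * t) + 1 / p * l powr (1 - p)"
    using assms t by (intro Youngs_inequality_0) (auto simp: field_simps)
  moreover have "(l * t) powr ((p - 1) / p) * (l powr (1 - p)) powr (1 / p) = t powr ((p - 1) / p)"
  proof -
    have "(1 - p) / p = - ((p - 1) / p)" by (simp add: minus_divide_left)
    then have "(l powr (1 - p)) powr (1 / p) = l powr (- ((p - 1) / p))"
      by (simp add: powr_powr)
    then show ?thesis using assms t by (simp add: powr_mult powr_minus field_simps)
  qed
  ultimately show ?thesis by (simp add: algebra_simps)
qed

lemma tendsto_0_if_eventually_small:
  fixes f :: "'a \<Rightarrow> real"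
  assumes "\<forall>\<^sub>F x in F. 0 \<le> f x" "\<And>e. e > 0 \<Longrightarrow> \<forall>\<^sub>F x in F. f x < e"
  shows "(f \<longlongrightarrow> 0) F"
  using assms by (intro order_tendstoI) (auto elim: eventually_mono)

section \<open>The two decay hypotheses of \<open>liouville\<close> in cases (I) and (II)\<close>

context semilinear_system
begin

lemma power_mass_nonneg: "power_mass a r \<ge> 0"
  unfolding power_mass_def by (auto intro!: integral_nonneg_AE AE_I2)

lemma scaled_masses_eventually_nonneg:
  "\<forall>\<^sub>F r in at_top. 0 \<le> r\<^sup>2 / r ^ DIM('a) * potential_mass r"
  "\<forall>\<^sub>F r in at_top. 0 \<le> r\<^sup>2 / r ^ DIM('a) * power_mass a r"
  by (rule eventually_mono[OF eventually_gt_at_top[of 0]]; simp add: masses_nonneg power_mass_nonneg)+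

lemma power_mass_le:
  assumes r: "r > 0" and l: "l > 0" and p: "p > 1"
  shows "power_mass ((p - 1) / p) r \<le> (p - 1) / p * l * potential_mass r
    + l powr (1 - p) / p * (measure lborel (ball (0::'a) 1) * r ^ DIM('a))"
proof -
  note int = cutoff_integrable(2)[OF _ r]
  have i1: "integrable lborel (\<lambda>x. (cutoff r x)\<^sup>2 * W (u x))" by (intro int cont_intros)
  have i2: "integrable lborel (\<lambda>x::'a. (cutoff r x)\<^sup>2)"
    using int[of "\<lambda>_. 1"] by simp
  have "power_mass ((p - 1) / p) r \<le> (\<integral>x. (p - 1) / p * l * ((cutoff r x)\<^sup>2 * W (u x))
      + l powr (1 - p) / p * (cutoff r x)\<^sup>2 \<partial>lborel)"
    unfolding power_mass_def
  proof (rule integral_mono)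
    show "integrable lborel (\<lambda>x. (cutoff r x)\<^sup>2 * W (u x) powr ((p - 1) / p))"
      using p by (intro int Wu_powr_cont) auto
    show "integrable lborel (\<lambda>x. (p - 1) / p * l * ((cutoff r x)\<^sup>2 * W (u x)) + l powr (1 - p) / p * (cutoff r x)\<^sup>2)"
      by (intro Bochner_Integration.integrable_add integrable_mult_right i1 i2)
    fix x
    show "(cutoff r x)\<^sup>2 * W (u x) powr ((p - 1) / p)
        \<le> (p - 1) / p * l * ((cutoff r x)\<^sup>2 * W (u x)) + l powr (1 - p) / p * (cutoff r x)\<^sup>2"
      using mult_left_mono[OF powr_le_linear[OF W_nonneg[of "u x"] l p], of "(cutoff r x)\<^sup>2"]
      by (simp add: algebra_simps)
  qed
  also have "\<dots> = (p - 1) / p * l * potential_mass r + l powr (1 - p) / p * (\<integral>x. (cutoff r (x::'a))\<^sup>2 \<partial>lborel)"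
    by (subst Bochner_Integration.integral_add) (auto intro!: integrable_mult_right i1 i2 simp: potential_mass_def)
  also have "\<dots> \<le> (p - 1) / p * l * potential_mass r
      + l powr (1 - p) / p * (measure lborel (ball (0::'a) 1) * r ^ DIM('a))"
    using p by (intro add_left_mono mult_left_mono integral_cutoff_square_le r) auto
  finally show ?thesis .
qed

text \<open>The exponent is the one for which a weight \<open>l\<close> of order r^(2/(p-1)) turns
  the assumed decay into o(r^(n-2)) for the term linear in \<open>W\<close>, while the volume term
  has order r^(n-2) with a coefficient that is small when \<open>k\<close> is large.\<close>

lemma constant_if_potential_mass_smallo:
  assumes bdd: "bounded (range u)" and p: "p > 1"
    and growth: "\<And>v. - ((v - Q) \<bullet> gW v) \<le> C * W v powr ((p - 1) / p)"
    and small: "((\<lambda>r. potential_mass r / r powr (real DIM('a) - 2 - 2 / (p - 1))) \<longlongrightarrow> 0) at_top"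
  shows "u constant_on UNIV"
proof -
  define h where "h r = potential_mass r / r powr (real DIM('a) - 2 - 2 / (p - 1))" for r
  have h0: "(h \<longlongrightarrow> 0) at_top" using small unfolding h_def .
  define V where "V = measure lborel (ball (0::'a) 1)"
  have scale: "r\<^sup>2 / r ^ DIM('a) * potential_mass r = r powr (- (2 / (p - 1))) * h r" if "r > 0" for r
  proof -
    have "r powr (real DIM('a) - 2 - 2 / (p - 1)) = r ^ DIM('a) / r\<^sup>2 * r powr (- (2 / (p - 1)))"
      using that by (simp add: powr_diff powr_realpow powr_minus divide_inverse)
    then show ?thesis using that by (simp add: h_def)
  qed
  show ?thesis
  proof (rule liouville[OF bdd _ growth])
    show "(p - 1) / p > 0" using p by simp
    show "((\<lambda>r. r\<^sup>2 / r ^ DIM('a) * potential_mass r) \<longlongrightarrow> 0) at_top"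
    proof (rule Lim_null_comparison[OF _ h0])
      show "\<forall>\<^sub>F r in at_top. norm (r\<^sup>2 / r ^ DIM('a) * potential_mass r) \<le> h r"
        using eventually_ge_at_top[of 1]
      proof eventually_elim
        case (elim r)
        have "r powr (- (2 / (p - 1))) \<le> r powr 0" using elim p by (intro powr_mono) auto
        moreover have "h r \<ge> 0" using masses_nonneg(2) by (simp add: h_def)
        ultimately show ?case using elim
          by (simp add: scale[unfolded times_divide_eq_left] abs_mult mult_left_le_one_le)
      qed
    qed
    show "((\<lambda>r. r\<^sup>2 / r ^ DIM('a) * power_mass ((p - 1) / p) r) \<longlongrightarrow> 0) at_top"
    proof (rule tendsto_0_if_eventually_small)
      fix e :: real assume e: "e > 0"
      \<comment> \<open>After scaling, \<open>s k\<close> is the volume term of Young's inequality.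
        It does not depend on \<open>r\<close>, so \<open>k\<close> is fixed first and
        \<open>r\<close> is sent to infinity afterwards.\<close>
      define s where "s k = k powr (1 - p) / p * V" for k
      have "((\<lambda>k::real. k powr (1 - p)) \<longlongrightarrow> 0) at_top"
        using p by (intro tendsto_neg_powr filterlim_ident) auto
      then have "(s \<longlongrightarrow> 0) at_top"
        unfolding s_def by (intro tendsto_mult_left_zero tendsto_divide_zero)
      then have "\<forall>\<^sub>F k in at_top. s k < e / 2 \<and> k > 0"
        using e by (intro eventually_conj eventually_gt_at_top order_tendstoD(2)) auto
      then obtain k where k: "s k < e / 2" "k > 0"
        using eventually_happens'[OF trivial_limit_at_top_linorder] by blast
      have "((\<lambda>r. (p - 1) / p * k * h r) \<longlongrightarrow> 0) at_top"
        by (intro tendsto_mult_right_zero h0)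
      then have "\<forall>\<^sub>F r in at_top. (p - 1) / p * k * h r < e / 2 \<and> r > 0"
        using e by (intro eventually_conj eventually_gt_at_top order_tendstoD(2)) auto
      then show "\<forall>\<^sub>F r in at_top. r\<^sup>2 / r ^ DIM('a) * power_mass ((p - 1) / p) r < e"
      proof eventually_elim
        case (elim r)
        then have r: "r > 0" by simp
        \<comment> \<open>With this weight both terms of Young's inequality scale like \<open>r\<^bsup>n-2\<^esup>\<close>.\<close>
        define l where "l = k * r powr (2 / (p - 1))"
        have l: "l > 0" using k r by (simp add: l_def)
        have l1: "l * r powr (- (2 / (p - 1))) = k"
          using r by (simp add: l_def powr_minus)
        have l2: "l powr (1 - p) = k powr (1 - p) / r\<^sup>2"
        proof -
          have "2 / (p - 1) * (1 - p) = - 2" using p by (simp add: divide_eq_eq)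
          then have eq: "(r powr (2 / (p - 1))) powr (1 - p) = r powr (- 2)"
            by (simp only: powr_powr)
          have "l powr (1 - p) = k powr (1 - p) * (r powr (2 / (p - 1))) powr (1 - p)"
            unfolding l_def by (rule powr_mult)
          also have "\<dots> = k powr (1 - p) * (1 / r\<^sup>2)"
            unfolding eq using r powr_minus_divide[of r 2] by (simp add: powr_numeral)
          finally show ?thesis by simp
        qed
        have "r\<^sup>2 / r ^ DIM('a) * power_mass ((p - 1) / p) r \<le> r\<^sup>2 / r ^ DIM('a) *
          ((p - 1) / p * l * potential_mass r + l powr (1 - p) / p * (V * r ^ DIM('a)))"
          unfolding V_def using r by (intro mult_left_mono power_mass_le l p) auto
        also have "\<dots> = (p - 1) / p * l * (r\<^sup>2 / r ^ DIM('a) * potential_mass r) + r\<^sup>2 * (l powr (1 - p) / p) * V"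
        proof -
          have scaled: "x / y * (a * l * b + c * (d * y)) = a * l * (x / y * b) + x * c * d"
            if "y \<noteq> 0" for a b c d x y :: real
            using that by (simp add: field_simps)
          show ?thesis by (rule scaled) (use r in simp)
        qed
        also have "\<dots> = (p - 1) / p * (l * r powr (- (2 / (p - 1)))) * h r + s k"
          using r unfolding scale[OF r] l2 s_def by (simp add: mult.assoc)
        also have "\<dots> < e" using elim k unfolding l1 by linarith
        finally show ?case .
      qed
    qed (rule scaled_masses_eventually_nonneg)
  qed
qed

text \<open>Here the exponent of case (I) is zero, and integrability bounds the mass without making
  it small. The smallness comes from the tail: inside a fixed ball the integral of the square root
  of \<open>W\<close> is a constant, killed by the factor 1/r^2, and outside it Young's inequality
  meets only the tail of the integral of \<open>W\<close>.\<close>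

lemma constant_if_potential_integrable:
  assumes bdd: "bounded (range u)" and dim: "DIM('a) = 4"
    and growth: "\<And>v. - ((v - Q) \<bullet> gW v) \<le> C * W v powr (1 / 2)"
    and int: "integrable lborel (\<lambda>x. W (u x))"
  shows "u constant_on UNIV"
proof -
  define V where "V = measure lborel (ball (0::'a) 1)"
  define T where "T = (\<integral>x. W (u x) \<partial>lborel)"
  have sq: "((\<lambda>r::real. c / r\<^sup>2) \<longlongrightarrow> 0) at_top" for c
    by (intro tendsto_divide_0[OF tendsto_const] filterlim_at_top_imp_at_infinity filterlim_pow_at_top filterlim_ident) auto
  show ?thesis
  proof (rule liouville[OF bdd _ growth])
    show "((\<lambda>r. r\<^sup>2 / r ^ DIM('a) * potential_mass r) \<longlongrightarrow> 0) at_top"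
    proof (rule Lim_null_comparison[OF _ sq])
      show "\<forall>\<^sub>F r in at_top. norm (r\<^sup>2 / r ^ DIM('a) * potential_mass r) \<le> T / r\<^sup>2"
        using eventually_gt_at_top[of 0]
      proof eventually_elim
        case (elim r)
        have "potential_mass r \<le> T"
          unfolding potential_mass_def T_def
          using cutoff_integrable(2)[OF Wu_cont elim]
          by (intro integral_mono int) (auto simp: W_nonneg cutoff_square_le_1 mult_left_le_one_le)
        then show ?case using elim masses_nonneg(2)[of r]
          by (simp add: dim abs_mult field_simps power2_eq_square power4_eq_xxxx)
      qed
    qed
    show "((\<lambda>r. r\<^sup>2 / r ^ DIM('a) * power_mass (1 / 2) r) \<longlongrightarrow> 0) at_top"
    proof (rule tendsto_0_if_eventually_small)
      fix e :: real assume e: "e > 0"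
      \<comment> \<open>Any positive \<open>k\<close> with \<open>V / k < e\<close> serves; the
        summand 1 keeps it positive and the inequality strict.\<close>
      define k where "k = (V + 1) / e"
      have k: "k > 0" using e by (simp add: k_def V_def add_nonneg_pos)
      have Vk: "V / k < e" using e by (simp add: k_def V_def field_simps add_nonneg_pos)
      have "(\<lambda>n. \<integral>x. indicator {x. norm x \<ge> real n} x * W (u x) \<partial>lborel) \<longlonglongrightarrow> (\<integral>x. 0 \<partial>(lborel :: 'a measure))"
      proof (rule integral_dominated_convergence[OF _ _ int])
        show "(\<lambda>x. indicator {x. norm x \<ge> real n} x * W (u x)) \<in> borel_measurable lborel" for n
          using int by measurable
        have "\<forall>\<^sub>F n in sequentially. indicator {x. norm x \<ge> real n} x * W (u x) = 0" for x :: 'a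
        proof -
          obtain N :: nat where "norm x < real N" using reals_Archimedean2 by blast
          then show ?thesis by (intro eventually_sequentiallyI[of N]) (auto simp: indicator_def)
        qed
        then show "AE x in lborel. (\<lambda>n. indicator {x. norm x \<ge> real n} x * W (u x)) \<longlonglongrightarrow> 0"
          by (intro AE_I2 tendsto_eventually)
        show "AE x in lborel. norm (indicator {x. norm x \<ge> real n} x * W (u x)) \<le> W (u x)" for n
          by (intro AE_I2) (auto simp: indicator_def W_nonneg)
      qed auto
      then have "\<forall>\<^sub>F n in sequentially. (\<integral>x. indicator {x. norm x \<ge> real n} x * W (u x) \<partial>lborel) < e / (2 * k)"
        using e k by (intro order_tendstoD(2)) auto
      \<comment> \<open>The three contributions at the end are below \<open>e / 4\<close> (inner
        ball), \<open>e / 4\<close> (tail times \<open>k / 2\<close>) and \<open>e / 2\<close>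
        (volume).\<close>
      then obtain n where n: "(\<integral>x. indicator {x. norm x \<ge> real n} x * W (u x) \<partial>lborel) < e / (2 * k)"
        using eventually_happens'[OF sequentially_bot] by blast
      define R where "R = real n"
      define \<eta> where "\<eta> = (\<integral>x. indicator {x. norm x \<ge> R} x * W (u x) \<partial>lborel)"
      define A where "A = (\<integral>x. indicator (cball 0 R) x *\<^sub>R W (u x) powr (1 / 2) \<partial>lborel)"
      have iA: "integrable lborel (\<lambda>x. indicator (cball 0 R) x *\<^sub>R W (u x) powr (1 / 2))"
        by (intro borel_integrable_compact Wu_powr_cont) auto
      have i\<eta>: "integrable lborel (\<lambda>x. indicator {x. norm x \<ge> R} x * W (u x))"
        by (rule Bochner_Integration.integrable_bound[OF int])
          (use int in \<open>auto simp: indicator_def W_nonneg\<close>)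
      have "\<forall>\<^sub>F r in at_top. A / r\<^sup>2 < e / 4 \<and> r > 0"
        using e by (intro eventually_conj eventually_gt_at_top order_tendstoD(2)[OF sq]) auto
      then show "\<forall>\<^sub>F r in at_top. r\<^sup>2 / r ^ DIM('a) * power_mass (1 / 2) r < e"
      proof eventually_elim
        case (elim r)
        then have r: "r > 0" by simp
        \<comment> \<open>With this weight both Young terms have order r^2, which the factor r^2/r^4
          turns into constants.\<close>
        define l where "l = k * r\<^sup>2"
        have l: "l > 0" using k r by (simp add: l_def)
        have ic: "integrable lborel (\<lambda>x::'a. (cutoff r x)\<^sup>2)"
          using cutoff_integrable(2)[of "\<lambda>_. 1" r] r by simp
        have "power_mass (1 / 2) r \<le> (\<integral>x. indicator (cball 0 R) x *\<^sub>R W (u x) powr (1 / 2)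
            + (l / 2 * (indicator {x. norm x \<ge> R} x * W (u x)) + 1 / (2 * l) * (cutoff r x)\<^sup>2) \<partial>lborel)"
          unfolding power_mass_def
        proof (rule integral_mono)
          show "integrable lborel (\<lambda>x. (cutoff r x)\<^sup>2 * W (u x) powr (1 / 2))"
            by (intro cutoff_integrable Wu_powr_cont r) auto
          show "integrable lborel (\<lambda>x. indicator (cball 0 R) x *\<^sub>R W (u x) powr (1 / 2)
            + (l / 2 * (indicator {x. norm x \<ge> R} x * W (u x)) + 1 / (2 * l) * (cutoff r x)\<^sup>2))"
            by (intro Bochner_Integration.integrable_add integrable_mult_right iA i\<eta> ic)
          fix x
          show "(cutoff r x)\<^sup>2 * W (u x) powr (1 / 2) \<le> indicator (cball 0 R) x *\<^sub>R W (u x) powr (1 / 2)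
            + (l / 2 * (indicator {x. norm x \<ge> R} x * W (u x)) + 1 / (2 * l) * (cutoff r x)\<^sup>2)"
          \<comment> \<open>The sphere \<open>norm x = R\<close> belongs to both sets; the overlap
            only enlarges the upper bound.\<close>
          proof (cases "norm x \<le> R")
            case True
            have "(cutoff r x)\<^sup>2 * W (u x) powr (1 / 2) \<le> W (u x) powr (1 / 2)"
              by (simp add: cutoff_square_le_1 mult_left_le_one_le)
            moreover have "0 \<le> l / 2 * (indicator {x. norm x \<ge> R} x * W (u x)) + 1 / (2 * l) * (cutoff r x)\<^sup>2"
              using l W_nonneg by simp
            ultimately show ?thesis using True by (simp add: indicator_def)
          next
            case False
            have "(cutoff r x)\<^sup>2 * W (u x) powr (1 / 2)
                \<le> (cutoff r x)\<^sup>2 * (l / 2 * W (u x) + 1 / (2 * l))"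
              using powr_le_linear[OF W_nonneg[of "u x"] l, of 2] l
              by (intro mult_left_mono) (auto simp: powr_minus field_simps)
            also have "\<dots> = (cutoff r x)\<^sup>2 * (l / 2 * W (u x)) + 1 / (2 * l) * (cutoff r x)\<^sup>2"
              by (simp add: algebra_simps)
            also have "\<dots> \<le> l / 2 * W (u x) + 1 / (2 * l) * (cutoff r x)\<^sup>2"
              using l W_nonneg by (intro add_right_mono mult_left_le_one_le) (auto simp: cutoff_square_le_1)
            finally show ?thesis using False by (simp add: indicator_def)
          qed
        qed
        also have "\<dots> = A + (l / 2 * \<eta> + 1 / (2 * l) * (\<integral>x. (cutoff r (x::'a))\<^sup>2 \<partial>lborel))"
          unfolding A_def \<eta>_def
          by (subst Bochner_Integration.integral_add[OF iA], fast intro: Bochner_Integration.integrable_add integrable_mult_right i\<eta> ic,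
              subst Bochner_Integration.integral_add) (auto intro!: integrable_mult_right i\<eta> ic)
        also have "\<dots> \<le> A + (l / 2 * \<eta> + 1 / (2 * l) * (V * r ^ DIM('a)))"
          using l unfolding V_def by (intro add_left_mono mult_left_mono integral_cutoff_square_le r) auto
        finally have "r\<^sup>2 / r ^ DIM('a) * power_mass (1 / 2) r
            \<le> r\<^sup>2 / r ^ DIM('a) * (A + (l / 2 * \<eta> + 1 / (2 * l) * (V * r ^ DIM('a))))"
          using r by (intro mult_left_mono) auto
        also have "\<dots> = A / r\<^sup>2 + k * \<eta> / 2 + V / k / 2"
          using r k by (simp add: dim l_def field_simps power2_eq_square power4_eq_xxxx)
        also have "\<dots> < e"
        proof -
          have "k * \<eta> < e / 2" using n k by (simp add: \<eta>_def R_def field_simps)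
          moreover have "V / k / 2 < e / 2" using Vk by simp
          ultimately show ?thesis using conjunct1[OF elim] by linarith
        qed
        finally show ?case .
      qed
    qed (rule scaled_masses_eventually_nonneg)
  qed simp
qed

lemma potential_mass_le_ball:
  assumes "r > 0"
  shows "potential_mass r \<le> (LINT x:ball 0 r|lborel. W (u x))"
  unfolding potential_mass_def set_lebesgue_integral_def
proof (rule integral_mono)
  show "integrable lborel (\<lambda>x. (cutoff r x)\<^sup>2 * W (u x))"
    by (intro cutoff_integrable Wu_cont assms)
  have "integrable lborel (\<lambda>x. indicator (cball 0 r) x *\<^sub>R W (u x))"
    by (intro borel_integrable_compact continuous_on_subset[OF Wu_cont]) auto
  then have "set_integrable lborel (cball 0 r) (\<lambda>x. W (u x))"
    by (simp add: set_integrable_def)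
  then have "set_integrable lborel (ball 0 r) (\<lambda>x. W (u x))"
    by (rule set_integrable_subset) auto
  then show "integrable lborel (\<lambda>x. indicator (ball 0 r) x *\<^sub>R W (u x))"
    by (simp add: set_integrable_def)
  show "(cutoff r x)\<^sup>2 * W (u x) \<le> indicator (ball 0 r) x *\<^sub>R W (u x)" for x
    using cutoff_eq_0[OF assms, of x] cutoff_square_le_1[of r x] W_nonneg[of "u x"]
    by (auto simp: indicator_def mult_left_le_one_le)
qed

end

section \<open>From partial derivatives and \<open>grad\<close> to the coordinate-free
  setting\<close>

lemma partial_deriv_eq:
  assumes "(f has_derivative f') (at x)"
  shows "partial_deriv i f x = f' (axis i 1)"
proof -
  have "((\<lambda>t. f (x + t *\<^sub>R axis i 1)) has_derivative (\<lambda>s. f' (s *\<^sub>R axis i 1))) (at 0)"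
    by (rule has_derivative_compose[where g = f]) (use assms in \<open>auto intro!: derivative_eq_intros\<close>)
  moreover have "f' (s *\<^sub>R axis i 1) = f' (axis i 1) * s" for s
    using linear_cmul[OF has_derivative_linear[OF assms]] by simp
  ultimately show ?thesis
    unfolding partial_deriv_def by (intro DERIV_imp_deriv) (simp add: has_field_derivative_def)
qed

lemma sum_Basis_vec:
  "(\<Sum>b\<in>Basis. g b) = (\<Sum>i\<in>UNIV. g (axis i 1 :: real ^ 'n))"
proof -
  have Basis: "(Basis :: (real ^ 'n) set) = range (\<lambda>i. axis i 1)" by (auto simp: Basis_vec_def)
  have inj: "inj (\<lambda>i. axis i 1 :: real ^ 'n)" by (auto simp: inj_def axis_eq_axis)
  show ?thesis unfolding Basis using sum.reindex[OF inj, of g] by (simp add: o_def)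
qed

lemma vec_laplacian_eq:
  fixes u :: "real ^ 'n \<Rightarrow> real ^ 'm"
  assumes D: "\<And>x. (u has_derivative blinfun_apply (D x)) (at x)"
    and D2: "\<And>x. (D has_derivative blinfun_apply (D2 x)) (at x)"
  shows "vec_laplacian u x = (\<Sum>b\<in>Basis. D2 x b b)"
proof -
  have 1: "((\<lambda>y. u y $ j) has_derivative (\<lambda>h. D y h $ j)) (at y)" for y j
    by (rule bounded_linear.has_derivative[OF bounded_linear_vec_nth D])
  have 2: "((\<lambda>y. D y b $ j) has_derivative (\<lambda>h. D2 y h b $ j)) (at y)" for y j b
    by (rule bounded_linear.has_derivative[OF bounded_linear_vec_nth])
      (auto intro!: derivative_eq_intros D2 simp: blinfun.zero_right)
  \<comment> \<open>The equation is between functions, since the outer partial derivative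
    differentiates the inner one.\<close>
  have "partial_deriv i (\<lambda>y. u y $ j) = (\<lambda>y. D y (axis i 1) $ j)" for i j
    by (rule ext) (rule partial_deriv_eq[OF 1])
  then have "laplacian (\<lambda>y. u y $ j) x = (\<Sum>i\<in>UNIV. D2 x (axis i 1) (axis i 1) $ j)" for j
    unfolding laplacian_def by (simp add: partial_deriv_eq[OF 2])
  then show ?thesis
    by (simp add: vec_laplacian_def vec_eq_iff sum_Basis_vec)
qed

text \<open>The Riesz vector of \<open>D v\<close>, written out in the basis, depends continuously
  on \<open>v\<close>, and uniqueness of the gradient identifies it with
  \<open>grad W v\<close>.\<close>

lemma C1_map_gradient:
  fixes W :: "'a::euclidean_space \<Rightarrow> real"
  assumes "C1_map W"
  shows "(W has_derivative (\<lambda>h. grad W v \<bullet> h)) (at v)" "continuous_on UNIV (grad W)"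
proof -
  obtain D :: "'a \<Rightarrow> 'a \<Rightarrow>\<^sub>L real" where D: "\<And>v. (W has_derivative blinfun_apply (D v)) (at v)"
    and cont: "continuous_on UNIV D"
    using assms unfolding C1_map_def by blast
  define g where "g v = (\<Sum>b\<in>Basis. D v b *\<^sub>R b)" for v
  have Dg: "D v h = g v \<bullet> h" for v h
  proof -
    have "D v h = D v (\<Sum>b\<in>Basis. (h \<bullet> b) *\<^sub>R b)" by (simp add: euclidean_representation)
    then show ?thesis
      by (simp add: g_def blinfun.sum_right blinfun.scaleR_right inner_sum_left inner_commute[of h] mult.commute)
  qed
  have W: "(W has_derivative (\<lambda>h. g v \<bullet> h)) (at v)" for v
    using D[of v] unfolding Dg[THEN ext] .
  then have "grad W v = g v" for v
    by (intro grad_eqI) (simp add: gderiv_def inner_commute)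
  then have "grad W = g" by (rule ext)
  then show "(W has_derivative (\<lambda>h. grad W v \<bullet> h)) (at v)" "continuous_on UNIV (grad W)"
    using W cont by (auto simp: g_def intro!: continuous_intros)
qed

theorem theorem0p1:
  fixes W :: "real^'m::finite \<Rightarrow> real"
    and u :: "real^'n::finite \<Rightarrow> real^'m"
    and Q :: "real^'m"
    and p C\<^sub>2 :: real
  assumes "CARD('m) \<ge> 2"
    and "C1_map W"
    and "\<forall>v. W v \<ge> 0"
    and "p \<ge> 2"
    and "C\<^sub>2 > 0"
    and "\<forall>v. - ((v - Q) \<bullet> grad W v) \<le> C\<^sub>2 * W v powr ((p - 1) / p)"
    and "C2_map u"
    and "bounded (range u)"
    and "\<forall>x. vec_laplacian u x = grad W (u x)"
  shows "(CARD('n) \<ge> 4 \<and>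
            (\<lambda>r::real. LINT x:ball 0 r|lborel. W (u x))
              \<in> o[at_top](\<lambda>r. r powr growth_exponent CARD('n) p)
          \<longrightarrow> u constant_on UNIV)
       \<and> (CARD('n) = 4 \<and> p = 2 \<and> (\<integral>\<^sup>+ x. ennreal (W (u x)) \<partial>lborel) < \<infinity>
          \<longrightarrow> u constant_on UNIV)"
proof -
  obtain D :: "real^'n \<Rightarrow> (real^'n) \<Rightarrow>\<^sub>L (real^'m)" where D: "\<And>x. (u has_derivative blinfun_apply (D x)) (at x)"
    and "C1_map D"
    using assms(7) unfolding C2_map_def by blast
  then obtain D2 where D2: "\<And>x. (D has_derivative blinfun_apply (D2 x)) (at x)"
    and D2_cont: "continuous_on UNIV D2"
    unfolding C1_map_def by blast
  interpret semilinear_system W "grad W" u D D2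
    using assms(3,9) vec_laplacian_eq[OF D D2]
    by unfold_locales (auto intro: C1_map_gradient[OF assms(2)] D D2 D2_cont)
  show ?thesis
  proof (intro conjI impI; elim conjE)
    assume "(\<lambda>r::real. LINT x:ball 0 r|lborel. W (u x)) \<in> o[at_top](\<lambda>r. r powr growth_exponent CARD('n) p)"
    then have lim: "((\<lambda>r. (LINT x:ball 0 r|lborel. W (u x)) / r powr growth_exponent CARD('n) p) \<longlongrightarrow> 0) at_top"
      by (rule smalloD_tendsto)
    \<comment> \<open>The squared cutoff lies below the indicator of the ball, so the decay of the
      ball integrals passes to \<open>potential_mass\<close>.\<close>
    have "((\<lambda>r. potential_mass r / r powr (real DIM(real^'n) - 2 - 2 / (p - 1))) \<longlongrightarrow> 0) at_top"
    proof (rule Lim_null_comparison[OF _ lim])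
      show "\<forall>\<^sub>F r in at_top. norm (potential_mass r / r powr (real DIM(real^'n) - 2 - 2 / (p - 1)))
          \<le> (LINT x:ball 0 r|lborel. W (u x)) / r powr growth_exponent CARD('n) p"
        using eventually_gt_at_top[of 0]
      proof eventually_elim
        case (elim r)
        then show ?case
          using potential_mass_le_ball[OF elim] masses_nonneg(2)[of r]
          by (simp add: growth_exponent_eq[OF assms(4)] divide_right_mono)
      qed
    qed
    then show "u constant_on UNIV"
      using assms(4,6,8) by (intro constant_if_potential_mass_smallo[where p = p and Q = Q and C = "C\<^sub>2"]) auto
  next
    assume "CARD('n) = 4" "p = 2" and fin: "(\<integral>\<^sup>+ x. ennreal (W (u x)) \<partial>lborel) < \<infinity>"
    have "integrable lborel (\<lambda>x. W (u x))"
      using fin borel_measurable_continuous_onI[OF Wu_cont] W_nonneg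
      by (intro integrableI_nonneg) auto
    then show "u constant_on UNIV"
      using assms(6,8) \<open>CARD('n) = 4\<close> \<open>p = 2\<close>
      by (intro constant_if_potential_integrable[where Q = Q and C = "C\<^sub>2"]) auto
  qed
qed

end
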